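(* Let the true parameters $(Q^*,\mathbf f^* )$ of the hidden Markov model satisfy: (A1) $\det Q^*\ne0$ and the true emission distributions are linearly independent; (A3) $Q^*_{ij}>0$ for all $i,j\in[R]$; (A4) the densities $f_r^*$ are continuous, (Lebesgue) almost everywhere positive, linearly independent, and $0<\inf_x\frac{f_r^*(x)}{f_s^*(x)}<\sup_x\frac{f_r^*(x)}{f_s^*(x)}<\infty$ for all $r,s\le R$. Let $g^{(3)}_{Q^*,\mathbf f}$ be the marginal density of $3$ consecutive observations under the parameters $(Q^*,\mathbf f)$, and $g^{(3)}_*=g^{(3)}_{Q^*,\mathbf f^*}$. Then there exists a constant $C=C(\mathbf f^*,Q^* )>0$ such that, for every vector of densities $\mathbf f=(f_1,\dots,f_R)$ with $\|g^{(3)}_{Q^*,\mathbf f}-g^{(3)}_*\|_{L^1}$ sufficiently small, up to label-swapping, $$\sum_{r=1}^R\|f_r-f_r^*\|_{L^1}\le C\,\|g^{(3)}_{Q^*,\mathbf f}-g^{(3)}_*\|_{L^1}.$$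
   Context: Observations lie in $\mathcal Y=[0,1]$ or $\mathcal Y=\mathbb R$; densities and $L^1$ norms are with respect to Lebesgue measure. $[R]=\{1,\dots,R\}$. In the HMM with parameters $(Q,\mathbf f)$, $(X_t)$ is a stationary Markov chain on $[R]$ with transition matrix $Q$, $Q_{rs}=\mathbb P(X_{t+1}=s\mid X_t=r)$, and invariant distribution $p_Q$. Given $(X_t)$ the $Y_t$ are independent with density $f_{X_t}$. The marginal density of three consecutive observations is $$g^{(3)}_{Q,\mathbf f}(y_1,y_2,y_3)=\sum_{i_1,i_2,i_3=1}^Rp_Q(i_1)Q_{i_1i_2}Q_{i_2i_3}f_{i_1}(y_1)f_{i_2}(y_2)f_{i_3}(y_3).$$ "Sufficiently small" means smaller than some $\delta>0$ depending only on $(Q^*,\mathbf f^* )$. **Up to label-swapping:** the left-hand side of the inequality is understood as the minimum of $\sum_r\|f_{\tau(r)}-f_r^*\|_{L^1}$ over permutations $\tau$ of $[R]$ such that $(Q^*_{\tau(r)\tau(s)})_{r,s}=Q^*$. If only the identity satisfies this, it is the printed left-hand side.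
   Formalization: In (A4) the bounds 0 < inf < sup < ∞ on f_r*/f_s* are required only for r ≠ s (at points where f_s* is nonzero), since for r = s the ratio is identically 1 and the strict inequality inf < sup cannot hold. *)

theory Defs
  imports "HOL-Analysis.Analysis"
begin

text \<open>
  The state space \<open>[R]\<close> is a finite index type \<open>'n\<close>, so that \<open>R = CARD('n) \<ge> 1\<close> is arbitrary.
  Emission densities are functions on \<^typ>\<open>real\<close> of which only the values on the observation
  space \<open>Y\<close> matter.
\<close>

definition obs_measure :: "real set \<Rightarrow> real measure" where
  "obs_measure Y = restrict_space lborel Y"

definition prob_density_on :: "real set \<Rightarrow> (real \<Rightarrow> real) \<Rightarrow> bool" where
  "prob_density_on Y h \<longleftrightarrow>
     (\<forall>y\<in>Y. 0 \<le> h y) \<and> has_bochner_integral (obs_measure Y) h 1"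

definition L1_norm :: "'a measure \<Rightarrow> ('a \<Rightarrow> real) \<Rightarrow> real" where
  "L1_norm M h = (LINT y|M. \<bar>h y\<bar>)"

definition transition_matrix :: "real ^ 'n ^ 'n \<Rightarrow> bool" where
  "transition_matrix Q \<longleftrightarrow> (\<forall>i j. 0 \<le> Q $ i $ j) \<and> (\<forall>i. (\<Sum>j\<in>UNIV. Q $ i $ j) = 1)"

text \<open>The invariant distribution is unique when all entries of \<open>Q\<close> are positive.\<close>

definition invariant_dist :: "real ^ 'n ^ 'n \<Rightarrow> real ^ 'n" where
  "invariant_dist Q =
     (THE p. (\<forall>i. 0 \<le> p $ i) \<and> (\<Sum>i\<in>UNIV. p $ i) = 1 \<and> p v* Q = p)"

definition hmm_density3 ::
    "real ^ 'n ^ 'n \<Rightarrow> ('n \<Rightarrow> real \<Rightarrow> real) \<Rightarrow> real \<times> real \<times> real \<Rightarrow> real" where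
  "hmm_density3 Q f = (\<lambda>(y1, y2, y3).
     \<Sum>i1\<in>UNIV. \<Sum>i2\<in>UNIV. \<Sum>i3\<in>UNIV.
       invariant_dist Q $ i1 * Q $ i1 $ i2 * Q $ i2 $ i3 * f i1 y1 * f i2 y2 * f i3 y3)"

definition hmm_density3_dist ::
    "real set \<Rightarrow> real ^ 'n ^ 'n \<Rightarrow> ('n \<Rightarrow> real \<Rightarrow> real) \<Rightarrow> ('n \<Rightarrow> real \<Rightarrow> real) \<Rightarrow> real" where
  "hmm_density3_dist Y Q f f' =
     L1_norm (obs_measure Y \<Otimes>\<^sub>M (obs_measure Y \<Otimes>\<^sub>M obs_measure Y))
       (\<lambda>y. hmm_density3 Q f y - hmm_density3 Q f' y)"

definition emission_distr :: "real set \<Rightarrow> (real \<Rightarrow> real) \<Rightarrow> real measure" where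
  "emission_distr Y h = density (obs_measure Y) (\<lambda>y. ennreal (h y))"

definition lin_indep_distrs :: "real set \<Rightarrow> ('n::finite \<Rightarrow> real \<Rightarrow> real) \<Rightarrow> bool" where
  "lin_indep_distrs Y f \<longleftrightarrow>
     (\<forall>c :: 'n \<Rightarrow> real.
        (\<forall>A\<in>sets (obs_measure Y). (\<Sum>r\<in>UNIV. c r * measure (emission_distr Y (f r)) A) = 0)
        \<longrightarrow> (\<forall>r. c r = 0))"

definition lin_indep_densities :: "real set \<Rightarrow> ('n::finite \<Rightarrow> real \<Rightarrow> real) \<Rightarrow> bool" where
  "lin_indep_densities Y f \<longleftrightarrow>
     (\<forall>c :: 'n \<Rightarrow> real.
        (AE y in obs_measure Y. (\<Sum>r\<in>UNIV. c r * f r y) = 0) \<longrightarrow> (\<forall>r. c r = 0))"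

definition assumption_A1 :: "real set \<Rightarrow> real ^ 'n ^ 'n \<Rightarrow> ('n \<Rightarrow> real \<Rightarrow> real) \<Rightarrow> bool" where
  "assumption_A1 Y Q f \<longleftrightarrow> det Q \<noteq> 0 \<and> lin_indep_distrs Y f"

definition assumption_A3 :: "real ^ 'n ^ 'n \<Rightarrow> bool" where
  "assumption_A3 Q \<longleftrightarrow> (\<forall>i j. 0 < Q $ i $ j)"

text \<open>
  Ratios are taken where the denominator does not vanish, i.e. off a null set, since a total
  division would return \<open>0\<close> there and spuriously force the infimum to \<open>0\<close>. By continuity, a zero of
  the denominator that is not a zero of the numerator still makes the supremum infinite.
  The case \<open>r = s\<close> is excluded below: that ratio is constantly \<open>1\<close>, so the strict inequality
  between infimum and supremum could never hold.
\<close>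

definition ratio_values :: "real set \<Rightarrow> (real \<Rightarrow> real) \<Rightarrow> (real \<Rightarrow> real) \<Rightarrow> ereal set" where
  "ratio_values Y h k = (\<lambda>y. ereal (h y / k y)) ` {y \<in> Y. k y \<noteq> 0}"

definition assumption_A4 :: "real set \<Rightarrow> ('n::finite \<Rightarrow> real \<Rightarrow> real) \<Rightarrow> bool" where
  "assumption_A4 Y f \<longleftrightarrow>
     (\<forall>r. continuous_on Y (f r)) \<and>
     (\<forall>r. AE y in obs_measure Y. 0 < f r y) \<and>
     lin_indep_densities Y f \<and>
     (\<forall>r s. r \<noteq> s \<longrightarrow>
        0 < Inf (ratio_values Y (f r) (f s)) \<and>
        Inf (ratio_values Y (f r) (f s)) < Sup (ratio_values Y (f r) (f s)) \<and>
        Sup (ratio_values Y (f r) (f s)) < \<infinity>)"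

definition label_symmetries :: "real ^ 'n ^ 'n \<Rightarrow> ('n \<Rightarrow> 'n) set" where
  "label_symmetries Q = {\<tau>. \<tau> permutes UNIV \<and> (\<chi> r s. Q $ \<tau> r $ \<tau> s) = Q}"

text \<open>The set of permutations is finite and contains the identity, so the minimum is attained.\<close>

definition emission_dist ::
    "real set \<Rightarrow> real ^ 'n ^ 'n \<Rightarrow> ('n \<Rightarrow> real \<Rightarrow> real) \<Rightarrow> ('n \<Rightarrow> real \<Rightarrow> real) \<Rightarrow> real" where
  "emission_dist Y Q f f' =
     Min ((\<lambda>\<tau>. \<Sum>r\<in>UNIV. L1_norm (obs_measure Y) (\<lambda>y. f (\<tau> r) y - f' r y)) ` label_symmetries Q)"

end

theory Submission
  imports Defs
begin

text \<open>
  Linear independence of the true emission distributions gives bounded test functions \<open>\<phi>\<^sub>a\<close> dual to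
  \<open>f\<^sup>*\<close>. Write \<open>M\<^sub>a\<^sub>i = \<integral>\<phi>\<^sub>a f\<^sub>i\<close> and \<open>S = diag(p) Q\<close>. Integrating the difference of the
  three-observation densities, of norm \<open>d\<close>, against products of the \<open>\<phi>\<^sub>a\<close> and of the constant \<open>1\<close>
  gives, up to \<open>O(d)\<close>, the identities \<open>M S diag(M\<^sub>b) Q M\<^sup>T = S diag(e\<^sub>b) Q\<close>,
  \<open>M S Q M\<^sup>T = S Q\<close> and \<open>M S M\<^sup>T = S\<close>. With \<open>W = S\<^sup>-\<^sup>1 M S\<close> the first two yield
  \<open>W diag(M\<^sub>b) = diag(e\<^sub>b) W + O(d)\<close>, where \<open>W\<close> has a bounded inverse, so \<open>M\<close> is within \<open>O(d)\<close> of
  the matrix of a permutation \<open>\<sigma>\<close>. Since there are finitely many permutations, the third identity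
  forces \<open>\<sigma>\<close> to preserve \<open>S\<close>, hence \<open>Q\<close>, as soon as \<open>d\<close> is small. Finally, testing only the
  first observation gives \<open>\<parallel>M S f - S f\<^sup>*\<parallel> = O(d)\<close> in \<open>L\<^sup>1\<close>, which is \<open>S (f \<circ> \<sigma> - f\<^sup>*) = O(d)\<close>, and
  \<open>S\<close> is invertible.
\<close>

section \<open>Matrices close to a permutation matrix\<close>

lemma matrix_add_rdistrib: "(A + B) ** C = A ** C + B ** C"
  by (simp add: matrix_matrix_mult_def vec_eq_iff distrib_right sum.distrib)

lemma matrix_diff_ldistrib:
  fixes A :: "'a::ring_1 ^ 'n ^ 'm"
  shows "A ** (B - C) = A ** B - A ** C"
  by (simp add: matrix_matrix_mult_def vec_eq_iff right_diff_distrib sum_subtractf)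

lemma matrix_diff_rdistrib:
  fixes A B :: "'a::ring_1 ^ 'n ^ 'm"
  shows "(A - B) ** C = A ** C - B ** C"
  by (simp add: matrix_matrix_mult_def vec_eq_iff left_diff_distrib sum_subtractf)

text \<open>This norm is submultiplicative, invariant under transposition and dominates every entry,
  so estimates of entries and of matrices convert into each other at the cost of a factor counting
  the entries.\<close>

definition entry_norm :: "real ^ 'n ^ 'm \<Rightarrow> real" where
  "entry_norm A = (\<Sum>i\<in>UNIV. \<Sum>j\<in>UNIV. \<bar>A $ i $ j\<bar>)"

lemma entry_norm_nonneg: "0 \<le> entry_norm A"
  by (simp add: entry_norm_def sum_nonneg)

lemma entry_norm_0 [simp]: "entry_norm 0 = 0"
  by (simp add: entry_norm_def)

lemma entry_le_entry_norm: "\<bar>A $ i $ j\<bar> \<le> entry_norm A"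
proof -
  have "\<bar>A $ i $ j\<bar> \<le> (\<Sum>j\<in>UNIV. \<bar>A $ i $ j\<bar>)"
    by (intro member_le_sum) auto
  also have "\<dots> \<le> entry_norm A"
    unfolding entry_norm_def by (rule member_le_sum) (auto intro: sum_nonneg)
  finally show ?thesis .
qed

lemma entry_norm_eq_0_iff: "entry_norm A = 0 \<longleftrightarrow> A = 0"
proof
  assume "entry_norm A = 0"
  then have "\<bar>A $ i $ j\<bar> \<le> 0" for i j
    using entry_le_entry_norm[of A i j] by simp
  then show "A = 0" by (simp add: vec_eq_iff)
qed simp

lemma entry_norm_add: "entry_norm (A + B) \<le> entry_norm A + entry_norm B"
proof -
  have "entry_norm (A + B) \<le> (\<Sum>i\<in>UNIV. \<Sum>j\<in>UNIV. \<bar>A $ i $ j\<bar> + \<bar>B $ i $ j\<bar>)"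
    unfolding entry_norm_def by (intro sum_mono) (simp add: abs_triangle_ineq)
  then show ?thesis by (simp add: entry_norm_def sum.distrib)
qed

lemma entry_norm_uminus [simp]: "entry_norm (- A) = entry_norm A"
  by (simp add: entry_norm_def)

lemma entry_norm_diff: "entry_norm (A - B) \<le> entry_norm A + entry_norm B"
  using entry_norm_add[of A "- B"] by simp

lemma entry_norm_transpose [simp]: "entry_norm (transpose A) = entry_norm A"
  unfolding entry_norm_def transpose_def by (simp, rule sum.swap)

lemma entry_norm_mult: "entry_norm (A ** B) \<le> entry_norm A * entry_norm B"
proof -
  have "entry_norm (A ** B) \<le> (\<Sum>i\<in>UNIV. \<Sum>k\<in>UNIV. \<Sum>j\<in>UNIV. \<bar>A $ i $ j\<bar> * \<bar>B $ j $ k\<bar>)"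
    unfolding entry_norm_def matrix_matrix_mult_def
    by (intro sum_mono) (simp flip: abs_mult add: sum_abs)
  also have "\<dots> = (\<Sum>i\<in>UNIV. \<Sum>j\<in>UNIV. \<bar>A $ i $ j\<bar> * (\<Sum>k\<in>UNIV. \<bar>B $ j $ k\<bar>))"
    by (subst sum.swap) (simp add: sum_distrib_left)
  also have "\<dots> \<le> (\<Sum>i\<in>UNIV. \<Sum>j\<in>UNIV. \<bar>A $ i $ j\<bar> * entry_norm B)"
    by (intro sum_mono mult_left_mono)
      (auto simp: entry_norm_def intro!: member_le_sum sum_nonneg)
  also have "\<dots> = entry_norm A * entry_norm B"
    by (simp add: entry_norm_def sum_distrib_right)
  finally show ?thesis .
qed

lemma entry_norm_mult_le:
  "entry_norm A \<le> a \<Longrightarrow> entry_norm B \<le> b \<Longrightarrow> entry_norm (A ** B) \<le> a * b"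
  by (meson entry_norm_mult entry_norm_nonneg mult_mono order_trans)

lemma entry_norm_bound:
  fixes A :: "real ^ 'n ^ 'm" and e :: real
  assumes "\<And>i j. \<bar>A $ i $ j\<bar> \<le> e"
  shows "entry_norm A \<le> CARD('m) * CARD('n) * e"
proof -
  have "entry_norm A \<le> (\<Sum>i\<in>(UNIV::'m set). \<Sum>j\<in>(UNIV::'n set). e)"
    unfolding entry_norm_def by (intro sum_mono assms)
  then show ?thesis by simp
qed

text \<open>The error \<open>E\<close> of \<open>W ** V\<close> is a contraction, so
  \<open>mat 1 + E\<close> is injective and \<open>W\<close> has an exact inverse \<open>Z\<close>.
  Then \<open>V ** W - mat 1 = Z ** E ** W\<close>, and \<open>Z\<close> is at most twice as large
  as the bound on \<open>V\<close>.\<close>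

lemma entry_norm_almost_inverse:
  fixes W V :: "real ^ 'n ^ 'n"
  assumes "entry_norm (W ** V - mat 1) \<le> 1/2" and "entry_norm W \<le> K" and "entry_norm V \<le> K"
  shows "entry_norm (V ** W - mat 1) \<le> 2 * K\<^sup>2 * entry_norm (W ** V - mat 1)"
proof -
  define E where "E = W ** V - mat 1"
  have WV: "W ** V = mat 1 + E" by (simp add: E_def)
  have small: "X = 0" if "E ** X = - X" for X :: "real ^ 'n ^ 'n"
  proof -
    have "entry_norm X \<le> entry_norm E * entry_norm X"
      using entry_norm_mult[of E X] that by simp
    also have "\<dots> \<le> 1/2 * entry_norm X"
      using assms(1) by (intro mult_right_mono) (auto simp: E_def entry_norm_nonneg)
    finally show "X = 0"
      using entry_norm_nonneg[of X] by (simp flip: entry_norm_eq_0_iff)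
  qed
  have "x = 0" if "(mat 1 + E) *v x = 0" for x
  proof -
    \<comment> \<open>All columns of \<open>X\<close> equal \<open>x\<close>, so that the estimate
      for matrices applies to a vector.\<close>
    define X :: "real ^ 'n ^ 'n" where "X = (\<chi> i j. x $ i)"
    have "E *v x = - x"
      using that by (simp add: matrix_vector_mult_add_rdistrib eq_neg_iff_add_eq_0 add.commute)
    then have "E ** X = - X"
      by (simp add: X_def vec_eq_iff matrix_matrix_mult_def matrix_vector_mult_def)
    then have "X = 0" by (rule small)
    then show "x = 0" by (simp add: X_def vec_eq_iff)
  qed
  then obtain F where F: "F ** (mat 1 + E) = mat 1"
    by (metis matrix_left_invertible_ker)
  then have "(mat 1 + E) ** F = mat 1" by (simp add: matrix_left_right_inverse)
  then have "W ** (V ** F) = mat 1" using WV by (simp add: matrix_mul_assoc)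
  then obtain Z where Z: "Z ** W = mat 1" by (metis matrix_left_right_inverse)
  have ZWV: "Z ** (W ** V) = V" by (simp add: matrix_mul_assoc Z)
  have "Z = V - Z ** E"
    using ZWV unfolding WV by (simp add: matrix_add_ldistrib eq_diff_eq)
  then have "entry_norm Z \<le> entry_norm V + entry_norm (Z ** E)"
    by (metis entry_norm_diff)
  \<comment> \<open>Half of the norm of \<open>Z\<close> is absorbed into the left-hand
    side.\<close>
  also have "\<dots> \<le> K + entry_norm Z * (1/2)"
    using assms by (intro add_mono entry_norm_mult_le) (auto simp: E_def)
  finally have nZ: "entry_norm Z \<le> 2 * K" by simp
  have "V ** W = Z ** (W ** V) ** W" by (simp add: ZWV)
  also have "\<dots> = mat 1 + Z ** E ** W"
    by (simp add: WV matrix_add_ldistrib matrix_add_rdistrib Z)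
  finally have "entry_norm (V ** W - mat 1) = entry_norm (Z ** E ** W)" by simp
  also have "\<dots> \<le> 2 * K * entry_norm E * K"
    using nZ assms by (intro entry_norm_mult_le) auto
  finally show ?thesis by (simp add: E_def power2_eq_square mult_ac)
qed

section \<open>Diagonal matrices and almost simultaneous diagonalisation\<close>

definition diag_matrix :: "real ^ 'n \<Rightarrow> real ^ 'n ^ 'n" where
  "diag_matrix v = (\<chi> i j. if i = j then v $ i else 0)"

lemma matrix_mult_diag_matrix [simp]: "(A ** diag_matrix v) $ i $ j = A $ i $ j * v $ j"
  by (simp add: matrix_matrix_mult_def diag_matrix_def if_distrib cong: if_cong)

lemma diag_matrix_mult [simp]: "(diag_matrix v ** A) $ i $ j = v $ i * A $ i $ j"
  by (simp add: matrix_matrix_mult_def diag_matrix_def if_distrib[of "\<lambda>x. x * _"] cong: if_cong)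

lemma entry_norm_diag_matrix: "entry_norm (diag_matrix v) = (\<Sum>i\<in>UNIV. \<bar>v $ i\<bar>)"
  by (simp add: entry_norm_def diag_matrix_def if_distrib[of abs] cong: if_cong)

text \<open>
  Almost simultaneous diagonalisation: \<open>W diag(m\<^sub>b) \<approx> diag(e\<^sub>b) W\<close> entrywise says that
  \<open>W\<^sub>i\<^sub>j (m\<^sub>b\<^sub>j - \<delta>\<^sub>b\<^sub>i)\<close> is small, and each row of \<open>W\<close> has an entry that is not small.
\<close>

lemma almost_permutation_matrix:
  fixes W V M :: "real ^ 'n ^ 'n"
  assumes W: "entry_norm W \<le> K" and V: "entry_norm V \<le> K" and M: "entry_norm M \<le> K"
    and K: "1 \<le> K"
    and WV: "entry_norm (W ** V - mat 1) \<le> e"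
    and WmV: "\<And>b. entry_norm (W ** diag_matrix (M $ b) ** V - diag_matrix (axis b 1)) \<le> e"
    and e: "16 * K ^ 5 * e < 1 / 2"
  shows "\<exists>\<sigma>. \<sigma> permutes UNIV \<and>
    (\<forall>b i. \<bar>M $ b $ \<sigma> i - (if i = b then 1 else 0)\<bar> \<le> 16 * K ^ 5 * e)"
proof -
  have e0: "0 \<le> e" using WV entry_norm_nonneg order_trans by blast
  \<comment> \<open>The factor \<open>16 * K ^ 5\<close> is at least 1, so the smallness hypothesis
    also yields the \<open>e \<le> 1 / 2\<close> that \<open>entry_norm_almost_inverse\<close>
    requires.\<close>
  have "1 * e \<le> 16 * K ^ 5 * e"
    using K e0 by (intro mult_right_mono) (auto intro: order_trans[OF one_le_power[OF K, of 5]])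
  then have e12: "e \<le> 1 / 2" using e by simp
  have VW: "entry_norm (V ** W - mat 1) \<le> 2 * K\<^sup>2 * e"
    using entry_norm_almost_inverse[of W V K] WV W V e12
    by (meson mult_left_mono order_trans zero_le_power2 mult_nonneg_nonneg zero_le_numeral)
  have main: "\<bar>W $ i $ j * (M $ b $ j - (if i = b then 1 else 0))\<bar> \<le> 4 * K ^ 4 * e" for i j b
  proof -
    let ?D = "diag_matrix (M $ b)" and ?E = "diag_matrix (axis b 1) :: real ^ 'n ^ 'n"
    have D: "entry_norm ?D \<le> K"
    proof -
      have "entry_norm ?D \<le> entry_norm M"
        unfolding entry_norm_diag_matrix unfolding entry_norm_def
        by (rule member_le_sum) (auto intro: sum_nonneg)
      then show ?thesis using M by simp
    qed
    \<comment> \<open>The factor \<open>V\<close> is removed by multiplying with \<open>W\<close> on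
      the right; the second term corrects for \<open>V ** W\<close> being only close to the
      identity.\<close>
    have "W ** ?D - ?E ** W = (W ** ?D ** V - ?E) ** W - W ** ?D ** (V ** W - mat 1)"
      by (simp add: matrix_mul_assoc matrix_diff_ldistrib matrix_diff_rdistrib)
    also have "entry_norm \<dots> \<le> e * K + K * K * (2 * K\<^sup>2 * e)"
      by (intro order_trans[OF entry_norm_diff] add_mono entry_norm_mult_le WmV W D VW)
    also have "\<dots> \<le> 2 * K ^ 4 * e + K * K * (2 * K\<^sup>2 * e)"
    proof -
      have "K ^ 1 \<le> K ^ 4" using K by (intro power_increasing) auto
      then have "K * e \<le> 2 * K ^ 4 * e"
        using e0 K by (intro mult_right_mono) auto
      then show ?thesis by (simp add: mult.commute)
    qed
    also have "\<dots> = 4 * K ^ 4 * e"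
      by (simp add: power2_eq_square power4_eq_xxxx)
    finally have "entry_norm (W ** ?D - ?E ** W) \<le> 4 * K ^ 4 * e" .
    then have "\<bar>(W ** ?D - ?E ** W) $ i $ j\<bar> \<le> 4 * K ^ 4 * e"
      using entry_le_entry_norm order_trans by blast
    moreover have "(W ** ?D - ?E ** W) $ i $ j
        = W $ i $ j * (M $ b $ j - (if i = b then 1 else 0))"
      by (auto simp: axis_def algebra_simps)
    ultimately show ?thesis by simp
  qed
  \<comment> \<open>If a whole row of \<open>W\<close> were small, the diagonal entry of
    \<open>W ** V\<close> in that row would be at most 1/4, although it is within 1/2 of 1.\<close>
  have "\<exists>j. 1 / (4 * K) \<le> \<bar>W $ i $ j\<bar>" for i
  proof (rule ccontr)
    assume "\<nexists>j. 1 / (4 * K) \<le> \<bar>W $ i $ j\<bar>"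
    then have small: "\<bar>W $ i $ j\<bar> \<le> 1 / (4 * K)" for j
      by (meson le_cases)
    have "(W ** V) $ i $ i \<le> (\<Sum>j\<in>UNIV. \<bar>W $ i $ j\<bar> * \<bar>V $ j $ i\<bar>)"
      unfolding matrix_matrix_mult_def
      by (simp flip: abs_mult) (intro sum_mono abs_ge_self)
    also have "\<dots> \<le> (\<Sum>j\<in>UNIV. 1 / (4 * K) * \<bar>V $ j $ i\<bar>)"
      by (intro sum_mono mult_right_mono small) auto
    also have "\<dots> = 1 / (4 * K) * (\<Sum>j\<in>UNIV. \<bar>V $ j $ i\<bar>)"
      by (simp add: sum_distrib_left)
    also have "\<dots> \<le> 1 / (4 * K) * K"
    proof (intro mult_left_mono)
      have "(\<Sum>j\<in>UNIV. \<bar>V $ j $ i\<bar>) \<le> entry_norm (V)"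
        unfolding entry_norm_def by (intro sum_mono member_le_sum) auto
      then show "(\<Sum>j\<in>UNIV. \<bar>V $ j $ i\<bar>) \<le> K" using V by simp
    qed (use K in auto)
    finally have "(W ** V) $ i $ i \<le> 1 / 4" using K by simp
    moreover have "\<bar>(W ** V - mat 1) $ i $ i\<bar> \<le> 1 / 2"
      using entry_le_entry_norm[of "W ** V - mat 1" i i] WV e12 by linarith
    ultimately show False by (simp add: mat_def)
  qed
  then obtain \<sigma> where \<sigma>: "\<And>i. 1 / (4 * K) \<le> \<bar>W $ i $ \<sigma> i\<bar>" by metis
  have close: "\<bar>M $ b $ \<sigma> i - (if i = b then 1 else 0)\<bar> \<le> 16 * K ^ 5 * e" (is "\<bar>?x\<bar> \<le> _") for b i
  proof -
    have "1 / (4 * K) * \<bar>?x\<bar> \<le> \<bar>W $ i $ \<sigma> i\<bar> * \<bar>?x\<bar>"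
      by (intro mult_right_mono \<sigma>) auto
    also have "\<dots> \<le> 4 * K ^ 4 * e"
      using main[of i "\<sigma> i" b] by (simp add: abs_mult)
    finally show ?thesis using K by (simp add: field_simps eval_nat_numeral)
  qed
  \<comment> \<open>If \<open>\<sigma> i = \<sigma> k\<close> with \<open>i\<close> and
    \<open>k\<close> distinct, one entry in row \<open>i\<close> of \<open>M\<close> would be at
    distance less than 1/2 from both 1 and 0.\<close>
  have "inj \<sigma>"
  proof (rule injI, rule ccontr)
    fix i k assume "\<sigma> i = \<sigma> k" "i \<noteq> k"
    then show False using close[of i i] close[of i k] e by (auto simp: abs_if split: if_splits)
  qed
  then have "bij \<sigma>" by (simp add: finite_UNIV_inj_surj bij_def)
  then have "\<sigma> permutes UNIV" by (rule bij_imp_permutes) simp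
  then show ?thesis using close by blast
qed

section \<open>From approximate matrix identities to an exact relabelling\<close>

lemma diag_matrix_1 [simp]: "diag_matrix 1 = mat 1"
  by (simp add: diag_matrix_def mat_def vec_eq_iff)

lemma transpose_diff: "transpose (A - B) = transpose A - transpose B"
  by (simp add: transpose_def vec_eq_iff)

text \<open>Conjugating the first two families of estimates by the inverses of \<open>S\<close> and
  \<open>Q\<close> brings them to the form of \<open>almost_permutation_matrix\<close>. The third
  makes the relabelled \<open>S\<close> close to \<open>S\<close>, and closeness is equality because
  the entries of \<open>S\<close> have only finitely many differences. The constants
  \<open>K\<close> and \<open>\<delta>\<close> are fixed before \<open>M\<close> and
  \<open>d\<close>.\<close>

lemma nearby_relabelling:
  fixes S Q :: "real ^ 'n ^ 'n" and B :: real
  assumes S: "invertible S" and Q: "invertible Q" and B: "0 \<le> B"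
  obtains K \<delta> where "0 < K" and "0 < \<delta>" and "\<And>M d. (\<And>a i. \<bar>M $ a $ i\<bar> \<le> B) \<Longrightarrow> d < \<delta> \<Longrightarrow>
    (\<And>b. entry_norm (M ** S ** diag_matrix (M $ b) ** Q ** transpose M
        - S ** diag_matrix (axis b 1) ** Q) \<le> d) \<Longrightarrow>
    entry_norm (M ** S ** Q ** transpose M - S ** Q) \<le> d \<Longrightarrow>
    entry_norm (M ** S ** transpose M - S) \<le> d \<Longrightarrow>
    \<exists>\<sigma>. \<sigma> permutes UNIV \<and> (\<forall>a b. S $ \<sigma> a $ \<sigma> b = S $ a $ b) \<and>
      (\<forall>b i. \<bar>M $ b $ \<sigma> i - (if i = b then 1 else 0)\<bar> \<le> K * d)"
proof -
  obtain S' where S': "S ** S' = mat 1" "S' ** S = mat 1"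
    using S by (auto simp: invertible_def)
  obtain Q' where Q': "Q ** Q' = mat 1" "Q' ** Q = mat 1"
    using Q by (auto simp: invertible_def)
  define R where "R = real CARD('n) * real CARD('n)"
  have R: "0 < R" by (simp add: R_def)
  define m where "m = R * B"
  have m: "0 \<le> m" using B R by (simp add: m_def)
  note nn = entry_norm_nonneg
  \<comment> \<open>One bound serves for \<open>M\<close>, \<open>W\<close> and \<open>V\<close> and
    for the factor lost in conjugating an error; the summand 1 secures
    \<open>1 \<le> K\<^sub>0\<close>.\<close>
  define K\<^sub>0 where "K\<^sub>0 = 1 + m + entry_norm S' * m * entry_norm S
    + entry_norm Q * m * entry_norm Q' + entry_norm S' * entry_norm Q'"
  have terms: "0 \<le> entry_norm S' * m * entry_norm S" "0 \<le> entry_norm Q * m * entry_norm Q'"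
    "0 \<le> entry_norm S' * entry_norm Q'"
    using m by (simp_all add: nn)
  have K\<^sub>0: "1 \<le> K\<^sub>0" "m \<le> K\<^sub>0" "entry_norm S' * m * entry_norm S \<le> K\<^sub>0"
    "entry_norm Q * m * entry_norm Q' \<le> K\<^sub>0" "entry_norm S' * entry_norm Q' \<le> K\<^sub>0"
    using terms m unfolding K\<^sub>0_def by linarith+
  \<comment> \<open>The factor \<open>16 * K\<^sub>0 ^ 5\<close> comes from
    \<open>almost_permutation_matrix\<close>, the sixth power from the conjugated error
    \<open>K\<^sub>0 * d\<close>.\<close>
  define K\<^sub>1 where "K\<^sub>1 = 16 * K\<^sub>0 ^ 6"
  have K\<^sub>1: "0 < K\<^sub>1" using K\<^sub>0(1) by (simp add: K\<^sub>1_def)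
  \<comment> \<open>The first two terms pay for replacing \<open>M\<close> by a permutation matrix
    in each outer factor of \<open>M ** S ** transpose M\<close>; the last pays for the error
    \<open>d\<close> of that product.\<close>
  define K\<^sub>2 where "K\<^sub>2 = R * K\<^sub>1 * entry_norm S * m + R * entry_norm S * (R * K\<^sub>1) + 1"
  have K\<^sub>2: "0 < K\<^sub>2"
    using R K\<^sub>1 m by (simp add: K\<^sub>2_def nn add_nonneg_pos)
  \<comment> \<open>\<open>G\<close> collects all differences of entries of \<open>S\<close>;
    \<open>\<gamma>\<close> separates the nonzero ones from 0.\<close>
  define G where "G = (\<lambda>(a, b, c, e). S $ a $ b - S $ c $ e) ` UNIV"
  have "finite G" by (simp add: G_def)
  then obtain \<gamma> where \<gamma>: "0 < \<gamma>" "\<And>x. x \<in> G \<Longrightarrow> x \<noteq> 0 \<Longrightarrow> \<gamma> \<le> dist 0 x"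
    using finite_set_avoid[of G 0] by blast
  have gap: "S $ a $ b = S $ c $ e" if "\<bar>S $ a $ b - S $ c $ e\<bar> < \<gamma>" for a b c e
  proof (rule ccontr)
    assume "S $ a $ b \<noteq> S $ c $ e"
    moreover have "S $ a $ b - S $ c $ e \<in> G"
      unfolding G_def by (rule image_eqI[of _ _ "(a, b, c, e)"]) auto
    ultimately show False using \<gamma>(2) that by (force simp: dist_real_def)
  qed
  \<comment> \<open>The first bound makes \<open>K\<^sub>1 * d\<close> less than 1/2, as the
    permutation requires; the second makes \<open>K\<^sub>2 * d\<close> less than the gap
    \<open>\<gamma>\<close>.\<close>
  define \<delta> where "\<delta> = min (1 / (2 * K\<^sub>1)) (\<gamma> / K\<^sub>2)"
  have "0 < \<delta>" using K\<^sub>1 K\<^sub>2 \<gamma>(1) by (simp add: \<delta>_def)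
  have "\<exists>\<sigma>. \<sigma> permutes UNIV \<and> (\<forall>a b. S $ \<sigma> a $ \<sigma> b = S $ a $ b) \<and>
      (\<forall>b i. \<bar>M $ b $ \<sigma> i - (if i = b then 1 else 0)\<bar> \<le> K\<^sub>1 * d)"
    if MB: "\<And>a i. \<bar>M $ a $ i\<bar> \<le> B" and d: "d < \<delta>"
    and three: "\<And>b. entry_norm (M ** S ** diag_matrix (M $ b) ** Q ** transpose M
        - S ** diag_matrix (axis b 1) ** Q) \<le> d"
    and outer: "entry_norm (M ** S ** Q ** transpose M - S ** Q) \<le> d"
    and two: "entry_norm (M ** S ** transpose M - S) \<le> d" for M d
  proof -
    have d0: "0 \<le> d" using two nn order_trans by blast
    have M: "entry_norm M \<le> m"
      using entry_norm_bound[of M B] MB by (simp add: m_def R_def)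
    define W where "W = S' ** M ** S"
    define V where "V = Q ** transpose M ** Q'"
    have conj_le: "entry_norm (S' ** X ** Q') \<le> K\<^sub>0 * d" if "entry_norm X \<le> d" for X
    proof -
      have "entry_norm (S' ** X ** Q') \<le> entry_norm S' * d * entry_norm Q'"
        using that by (intro entry_norm_mult_le) auto
      also have "\<dots> \<le> K\<^sub>0 * d"
        using mult_right_mono[OF K\<^sub>0(5) d0] by (simp add: mult_ac)
      finally show ?thesis .
    qed
    have sandwich: "S' ** (S ** X ** Q) ** Q' = X" for X
      by (metis S'(2) Q'(1) matrix_mul_assoc matrix_mul_lid matrix_mul_rid)
    have W: "entry_norm W \<le> K\<^sub>0"
      unfolding W_def by (rule order_trans[OF _ K\<^sub>0(3)]) (intro entry_norm_mult_le M order_refl)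
    have V: "entry_norm V \<le> K\<^sub>0"
      unfolding V_def by (rule order_trans[OF _ K\<^sub>0(4)])
        (intro entry_norm_mult_le order_refl, simp add: M)
    have WV: "entry_norm (W ** V - mat 1) \<le> K\<^sub>0 * d"
    proof -
      have "W ** V - mat 1 = S' ** (M ** S ** Q ** transpose M - S ** Q) ** Q'"
        using sandwich[of "mat 1"]
        by (simp add: W_def V_def matrix_diff_ldistrib matrix_diff_rdistrib matrix_mul_assoc)
      then show ?thesis using conj_le[OF outer] by simp
    qed
    have WmV: "entry_norm (W ** diag_matrix (M $ b) ** V - diag_matrix (axis b 1)) \<le> K\<^sub>0 * d" for b
    proof -
      have "W ** diag_matrix (M $ b) ** V - diag_matrix (axis b 1)
        = S' ** (M ** S ** diag_matrix (M $ b) ** Q ** transpose M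
          - S ** diag_matrix (axis b 1) ** Q) ** Q'"
        using sandwich[of "diag_matrix (axis b 1)"]
        by (simp add: W_def V_def matrix_diff_ldistrib matrix_diff_rdistrib matrix_mul_assoc)
      then show ?thesis using conj_le[OF three[of b]] by simp
    qed
    have K: "16 * K\<^sub>0 ^ 5 * (K\<^sub>0 * d) = K\<^sub>1 * d" by (simp add: K\<^sub>1_def eval_nat_numeral)
    have "K\<^sub>1 * d < 1 / 2"
      using d K\<^sub>1 by (simp add: \<delta>_def field_simps)
    with almost_permutation_matrix[OF W V order_trans[OF M K\<^sub>0(2)] K\<^sub>0(1) WV WmV]
    obtain \<sigma> where \<sigma>: "\<sigma> permutes UNIV"
      and close: "\<And>b i. \<bar>M $ b $ \<sigma> i - (if i = b then 1 else 0)\<bar> \<le> K\<^sub>1 * d"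
      unfolding K by blast
    define P :: "real ^ 'n ^ 'n" where "P = (\<chi> b j. if j = \<sigma> b then 1 else 0)"
    have MP: "entry_norm (M - P) \<le> R * K\<^sub>1 * d"
    proof -
      have "\<bar>(M - P) $ b $ j\<bar> \<le> K\<^sub>1 * d" for b j
      proof -
        \<comment> \<open>Surjectivity of \<open>\<sigma>\<close> lets the estimate at the columns
          \<open>\<sigma> i\<close> cover every column.\<close>
        obtain i where "j = \<sigma> i" using \<sigma> by (metis permutes_def)
        then show ?thesis
          using close[of b i] inj_eq[OF permutes_inj[OF \<sigma>]] by (simp add: P_def)
      qed
      then show ?thesis using entry_norm_bound[of "M - P" "K\<^sub>1 * d"] by (simp add: R_def)
    qed
    have P: "entry_norm P \<le> R"
      using entry_norm_bound[of P 1] by (simp add: P_def R_def)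
    have "S $ \<sigma> a $ \<sigma> b = S $ a $ b" for a b
    proof (rule gap)
      \<comment> \<open>The outer factors are exchanged one at a time, so each correction contains
        \<open>M - P\<close> once.\<close>
      have "P ** S ** transpose P - S = (M ** S ** transpose M - S)
          - ((M - P) ** S ** transpose M + P ** S ** transpose (M - P))"
        by (simp add: transpose_diff matrix_diff_ldistrib matrix_diff_rdistrib)
      then have "entry_norm (P ** S ** transpose P - S) = entry_norm \<dots>" by (rule arg_cong)
      also have "\<dots> \<le> entry_norm (M ** S ** transpose M - S)
          + (entry_norm ((M - P) ** S ** transpose M) + entry_norm (P ** S ** transpose (M - P)))"
        by (rule order_trans[OF entry_norm_diff add_left_mono[OF entry_norm_add]])
      also have "\<dots> \<le> d + (R * K\<^sub>1 * d * entry_norm S * m + R * entry_norm S * (R * K\<^sub>1 * d))"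
        by (intro add_mono two entry_norm_mult_le P MP order_refl) (simp_all add: M MP)
      also have "\<dots> = K\<^sub>2 * d" by (simp add: K\<^sub>2_def algebra_simps)
      also have "\<dots> < \<gamma>" using d K\<^sub>2 by (simp add: \<delta>_def field_simps)
      finally have "\<bar>(P ** S ** transpose P - S) $ a $ b\<bar> < \<gamma>"
        using entry_le_entry_norm order_le_less_trans by blast
      moreover have "(P ** S ** transpose P) $ a $ b = S $ \<sigma> a $ \<sigma> b"
        by (simp add: P_def matrix_matrix_mult_def transpose_def if_distrib[of "\<lambda>x. x * _"]
            if_distrib[of "\<lambda>x. _ * x"] cong: if_cong)
      ultimately show "\<bar>S $ \<sigma> a $ \<sigma> b - S $ a $ b\<bar> < \<gamma>" by simp
    qed
    then show ?thesis using \<sigma> close by blast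
  qed
  then show ?thesis by (rule that[OF K\<^sub>1 \<open>0 < \<delta>\<close>])
qed

section \<open>The invariant distribution of a positive transition matrix\<close>

lemma vector_matrix_mult_nth: "(v v* A) $ j = (\<Sum>i\<in>UNIV. v $ i * A $ i $ j)"
  by (simp add: vector_matrix_mult_def mult.commute)

lemma transition_matrix_sum_vector:
  assumes "transition_matrix Q"
  shows "(\<Sum>j\<in>UNIV. (v v* Q) $ j) = (\<Sum>i\<in>UNIV. v $ i)"
proof -
  have "(\<Sum>j\<in>UNIV. (v v* Q) $ j) = (\<Sum>i\<in>UNIV. \<Sum>j\<in>UNIV. v $ i * Q $ i $ j)"
    unfolding vector_matrix_mult_nth by (rule sum.swap)
  then show ?thesis
    using assms by (simp add: transition_matrix_def flip: sum_distrib_left)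
qed

text \<open>A single positive coordinate sends mass to every state in one step.\<close>

lemma positive_vector_matrix_mult:
  assumes Q: "assumption_A3 Q" and v: "\<And>i. 0 \<le> v $ i" "v \<noteq> 0"
  shows "0 < (v v* Q) $ j"
proof -
  obtain k where "v $ k \<noteq> 0" using v(2) by (auto simp: vec_eq_iff)
  then have "0 < v $ k" using v(1)[of k] by linarith
  then show ?thesis
    unfolding vector_matrix_mult_nth using Q v(1)
    by (intro sum_pos2[of _ k]) (auto simp: assumption_A3_def intro: mult_nonneg_nonneg less_imp_le)
qed

text \<open>Since the rows sum to one, \<open>Q - mat 1\<close> annihilates the all-ones vector; it
  is therefore singular, and so is its transpose.\<close>

lemma transition_matrix_left_fixed_vector:
  fixes Q :: "real ^ 'n ^ 'n"
  assumes "transition_matrix Q"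
  obtains v where "v \<noteq> 0" "v v* Q = v"
proof -
  have "\<exists>v. v \<noteq> 0 \<and> transpose (Q - mat 1) *v v = 0"
  proof (rule ccontr)
    assume "\<nexists>v. v \<noteq> 0 \<and> transpose (Q - mat 1) *v v = 0"
    then obtain B where "B ** transpose (Q - mat 1) = mat 1"
      by (metis matrix_left_invertible_ker)
    then have "transpose (B ** transpose (Q - mat 1)) = mat 1" by simp
    then have "transpose B ** (Q - mat 1) = mat 1"
      by (simp add: matrix_transpose_mul matrix_left_right_inverse)
    moreover have "(Q - mat 1) *v 1 = 0"
      using assms by (simp add: transition_matrix_def vec_eq_iff matrix_vector_mult_diff_rdistrib)
        (simp add: matrix_vector_mult_def)
    ultimately have "(1::real^'n) = 0"
      by (metis matrix_vector_mul_assoc matrix_vector_mul_lid matrix_vector_mult_0_right)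
    then show False by (simp add: vec_eq_iff)
  qed
  then obtain v where "v \<noteq> 0" "transpose (Q - mat 1) *v v = 0" by blast
  then have "v v* (Q - mat 1) = 0" by simp
  then have "v v* Q = v"
    by (simp add: vec_eq_iff vector_matrix_mult_nth right_diff_distrib sum_subtractf)
      (simp add: mat_def if_distrib cong: if_cong)
  then show thesis using \<open>v \<noteq> 0\<close> that by blast
qed

text \<open>This is a Perron-Frobenius argument. The vector \<open>u\<close> of absolute values
  satisfies \<open>u \<le> u v* Q\<close> coordinatewise, and conservation of total mass turns this
  into equality. Then \<open>u + v\<close> and \<open>u - v\<close> are nonnegative fixed vectors;
  if neither vanished, both would be strictly positive.\<close>

lemma fixed_vector_sign:
  fixes Q :: "real ^ 'n ^ 'n"
  assumes Q: "transition_matrix Q" "assumption_A3 Q" and v: "v v* Q = v" "v \<noteq> 0"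
  shows "(\<forall>i. 0 < v $ i) \<or> (\<forall>i. v $ i < 0)"
proof -
  define u :: "real ^ 'n" where "u = (\<chi> i. \<bar>v $ i\<bar>)"
  have le: "u $ j \<le> (u v* Q) $ j" for j
  proof -
    have "u $ j = \<bar>\<Sum>i\<in>UNIV. v $ i * Q $ i $ j\<bar>"
      using v(1) by (simp add: u_def flip: vector_matrix_mult_nth)
    also have "\<dots> \<le> (\<Sum>i\<in>UNIV. \<bar>v $ i * Q $ i $ j\<bar>)" by (rule sum_abs)
    also have "\<dots> = (u v* Q) $ j"
      using Q by (simp add: vector_matrix_mult_nth u_def abs_mult transition_matrix_def)
    finally show ?thesis .
  qed
  have "u $ j = (u v* Q) $ j" for j
  proof (rule ccontr)
    assume "u $ j \<noteq> (u v* Q) $ j"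
    with le[of j] have "u $ j < (u v* Q) $ j" by simp
    then have "(\<Sum>i\<in>UNIV. u $ i) < (\<Sum>j\<in>UNIV. (u v* Q) $ j)"
      using le by (intro sum_strict_mono_ex1) auto
    then show False using transition_matrix_sum_vector[OF Q(1), of u] by simp
  qed
  then have u: "u v* Q = u" by (simp add: vec_eq_iff)
  have upos: "0 < u $ j" for j
  proof -
    have "u \<noteq> 0" using v(2) by (auto simp: u_def vec_eq_iff)
    then show ?thesis using positive_vector_matrix_mult[OF Q(2), of u j] u by (simp add: u_def)
  qed
  have "u = v \<or> u = - v"
  proof (rule ccontr)
    assume "\<not> (u = v \<or> u = - v)"
    then have "u + v \<noteq> 0" "u - v \<noteq> 0" by (auto simp: eq_neg_iff_add_eq_0)
    have "0 < ((u + v) v* Q) $ j" "0 < ((u - v) v* Q) $ j" for j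
      by (rule positive_vector_matrix_mult[OF Q(2)], simp add: u_def, fact)+
    moreover have "(u + v) v* Q = u + v" "(u - v) v* Q = u - v"
      using u v(1) by (simp_all add: vec_eq_iff vector_matrix_mult_nth distrib_right
          left_diff_distrib sum.distrib sum_subtractf)
    ultimately have "0 < u $ j + v $ j" "0 < u $ j - v $ j" for j
      by (simp_all flip: vector_add_component vector_minus_component)
    \<comment> \<open>Any coordinate will do: there \<open>\<bar>v\<bar> + v\<close> or
      \<open>\<bar>v\<bar> - v\<close> is 0.\<close>
    from this[of undefined] show False by (simp add: u_def)
  qed
  then show ?thesis
  proof
    assume "u = - v"
    then have "v $ i = - u $ i" for i by simp
    then show ?thesis using upos by simp
  qed (use upos in simp)
qed

text \<open>This justifies the definite description. Dividing a fixed vector by its sum makes it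
  positive whatever its sign, and two invariant distributions would differ by a fixed vector of
  constant sign whose coordinates sum to 0.\<close>

lemma invariant_dist:
  fixes Q :: "real ^ 'n ^ 'n"
  assumes Q: "transition_matrix Q" "assumption_A3 Q"
  shows "0 < invariant_dist Q $ i" and "(\<Sum>i\<in>UNIV. invariant_dist Q $ i) = 1"
    and "invariant_dist Q v* Q = invariant_dist Q"
proof -
  let ?P = "\<lambda>p :: real ^ 'n. (\<forall>i. 0 \<le> p $ i) \<and> (\<Sum>i\<in>UNIV. p $ i) = 1 \<and> p v* Q = p"
  obtain v where v: "v \<noteq> 0" "v v* Q = v"
    using transition_matrix_left_fixed_vector[OF Q(1)] .
  define s where "s = (\<Sum>i\<in>UNIV. v $ i)"
  have s: "0 < v $ i / s" for i
  proof -
    from fixed_vector_sign[OF Q v(2,1)] show ?thesis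
    proof
      assume "\<forall>i. 0 < v $ i"
      then show ?thesis by (auto simp: s_def intro!: divide_pos_pos sum_pos)
    next
      assume neg: "\<forall>i. v $ i < 0"
      then have "0 < (\<Sum>i\<in>UNIV. - v $ i)" by (intro sum_pos) auto
      then show ?thesis using neg by (simp add: s_def sum_negf zero_less_divide_iff)
    qed
  qed
  then have "s \<noteq> 0" by force
  define p where "p = (1 / s) *\<^sub>R v"
  have "p v* Q = p"
    using v(2) by (simp add: p_def vec_eq_iff vector_matrix_mult_nth flip: sum_divide_distrib)
  then have P: "?P p"
    using s \<open>s \<noteq> 0\<close>
    by (auto simp: p_def less_imp_le simp flip: sum_divide_distrib s_def)
  have uniq: "q = p" if "?P q" for q
  proof (rule ccontr)
    assume "q \<noteq> p"
    then have "q - p \<noteq> 0" by simp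
    moreover have "(q - p) v* Q = q - p"
      using P that by (simp add: vec_eq_iff vector_matrix_mult_nth left_diff_distrib sum_subtractf)
    ultimately have "(\<forall>i. 0 < (q - p) $ i) \<or> (\<forall>i. (q - p) $ i < 0)"
      using fixed_vector_sign[OF Q] by blast
    then have "(\<Sum>i\<in>UNIV. (q - p) $ i) \<noteq> 0"
      using sum_pos[of UNIV "\<lambda>i. (q - p) $ i"] sum_pos[of UNIV "\<lambda>i. (p - q) $ i"]
      by (auto simp: sum_subtractf)
    then show False using P that by (simp add: sum_subtractf)
  qed
  have "invariant_dist Q = p"
    unfolding invariant_dist_def using P uniq by (rule the_equality)
  then show "0 < invariant_dist Q $ i" "(\<Sum>i\<in>UNIV. invariant_dist Q $ i) = 1"
    "invariant_dist Q v* Q = invariant_dist Q"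
    using P s by (auto simp: p_def)
qed

section \<open>Moments of the three-observation density\<close>

lemma (in pair_sigma_finite) has_bochner_integral_mult_pair:
  fixes f :: "'a \<Rightarrow> real" and g :: "'b \<Rightarrow> real"
  assumes f: "integrable M1 f" and g: "integrable M2 g"
  shows "has_bochner_integral (M1 \<Otimes>\<^sub>M M2) (\<lambda>(x, y). f x * g y)
    ((LINT x|M1. f x) * (LINT y|M2. g y))"
proof -
  have [measurable]: "f \<in> borel_measurable M1" "g \<in> borel_measurable M2"
    using f g by auto
  have int: "integrable (M1 \<Otimes>\<^sub>M M2) (\<lambda>(x, y). f x * g y)"
  proof (rule Fubini_integrable)
    show "integrable M1 (\<lambda>x. LINT y|M2. norm (case (x, y) of (x, y) \<Rightarrow> f x * g y))"
      using f by (simp add: abs_mult)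
    show "AE x in M1. integrable M2 (\<lambda>y. case (x, y) of (x, y) \<Rightarrow> f x * g y)"
      using g by simp
  qed measurable
  moreover have "(LINT z|(M1 \<Otimes>\<^sub>M M2). (case z of (x, y) \<Rightarrow> f x * g y))
      = (LINT x|M1. f x) * (LINT y|M2. g y)"
    using integral_fst'[OF int] by simp
  ultimately show ?thesis by (simp add: has_bochner_integral_iff)
qed

lemma (in sigma_finite_measure) has_bochner_integral_mult_triple:
  fixes f g h :: "'a \<Rightarrow> real"
  assumes "integrable M f" "integrable M g" "integrable M h"
  shows "has_bochner_integral (M \<Otimes>\<^sub>M (M \<Otimes>\<^sub>M M)) (\<lambda>(x, y, z). f x * g y * h z)
    ((LINT x|M. f x) * (LINT x|M. g x) * (LINT x|M. h x))"
proof -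
  interpret P2: pair_sigma_finite M M ..
  interpret P3: pair_sigma_finite M "M \<Otimes>\<^sub>M M" ..
  have "has_bochner_integral (M \<Otimes>\<^sub>M M) (\<lambda>(y, z). g y * h z) ((LINT x|M. g x) * (LINT x|M. h x))"
    using assms(2,3) by (rule P2.has_bochner_integral_mult_pair)
  then have "integrable (M \<Otimes>\<^sub>M M) (\<lambda>(y, z). g y * h z)"
    and "(LINT u|(M \<Otimes>\<^sub>M M). (case u of (y, z) \<Rightarrow> g y * h z)) = (LINT x|M. g x) * (LINT x|M. h x)"
    by (simp_all add: has_bochner_integral_iff)
  with P3.has_bochner_integral_mult_pair[OF assms(1), of "\<lambda>(y, z). g y * h z"] show ?thesis
    by (simp add: mult.assoc case_prod_unfold)
qed

lemma integrable_bounded_mult: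
  fixes h \<phi> :: "'a \<Rightarrow> real"
  assumes h: "integrable M h" and [measurable]: "\<phi> \<in> borel_measurable M"
    and B: "\<And>x. x \<in> space M \<Longrightarrow> \<bar>\<phi> x\<bar> \<le> B"
  shows "integrable M (\<lambda>x. \<phi> x * h x)"
proof (rule Bochner_Integration.integrable_bound)
  show "integrable M (\<lambda>x. B * h x)" using h by simp
  show "AE x in M. norm (\<phi> x * h x) \<le> norm (B * h x)"
    using B by (intro AE_I2) (force simp: abs_mult intro!: mult_right_mono)
qed (use h in measurable)

lemma integral_abs_le_bounded_mult:
  fixes h \<phi> :: "'a \<Rightarrow> real"
  assumes h: "integrable M h" and [measurable]: "\<phi> \<in> borel_measurable M"
    and B: "\<And>x. x \<in> space M \<Longrightarrow> \<bar>\<phi> x\<bar> \<le> B"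
  shows "\<bar>LINT x|M. \<phi> x * h x\<bar> \<le> B * L1_norm M h"
proof -
  have "\<bar>LINT x|M. \<phi> x * h x\<bar> \<le> (LINT x|M. \<bar>\<phi> x * h x\<bar>)" by (rule integral_abs_bound)
  also have "\<dots> \<le> (LINT x|M. B * \<bar>h x\<bar>)"
    using B by (intro integral_mono integrable_abs integrable_bounded_mult[OF h, of _ B]
        integrable_mult_right h) (auto simp: abs_mult intro!: mult_right_mono)
  finally show ?thesis by (simp add: L1_norm_def)
qed

text \<open>As a trilinear form this covers both uses: point values of the emission densities give
  the joint density, and their integrals against test functions give its product moments.\<close>

definition moment3 ::
    "real ^ 'n ^ 'n \<Rightarrow> ('n \<Rightarrow> real) \<Rightarrow> ('n \<Rightarrow> real) \<Rightarrow> ('n \<Rightarrow> real) \<Rightarrow> real" where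
  "moment3 Q a b c = (\<Sum>i1\<in>UNIV. \<Sum>i2\<in>UNIV. \<Sum>i3\<in>UNIV.
     invariant_dist Q $ i1 * Q $ i1 $ i2 * Q $ i2 $ i3 * (a i1 * b i2 * c i3))"

lemma hmm_density3_eq_moment3:
  "hmm_density3 Q f (x, y, z) = moment3 Q (\<lambda>i. f i x) (\<lambda>i. f i y) (\<lambda>i. f i z)"
  by (simp add: hmm_density3_def moment3_def mult.assoc)

text \<open>Along a fixed hidden path the three observations are independent, so each summand
  factorises and Fubini's theorem applies termwise.\<close>

lemma (in sigma_finite_measure) has_bochner_integral_hmm_density3:
  fixes f :: "'n::finite \<Rightarrow> 'a \<Rightarrow> real"
  assumes "\<And>i. integrable M (\<lambda>x. \<phi>\<^sub>1 x * f i x)" "\<And>i. integrable M (\<lambda>x. \<phi>\<^sub>2 x * f i x)"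
    "\<And>i. integrable M (\<lambda>x. \<phi>\<^sub>3 x * f i x)"
  shows "has_bochner_integral (M \<Otimes>\<^sub>M (M \<Otimes>\<^sub>M M))
    (\<lambda>(x, y, z). \<phi>\<^sub>1 x * \<phi>\<^sub>2 y * \<phi>\<^sub>3 z * moment3 Q (\<lambda>i. f i x) (\<lambda>i. f i y) (\<lambda>i. f i z))
    (moment3 Q (\<lambda>i. LINT x|M. \<phi>\<^sub>1 x * f i x) (\<lambda>i. LINT x|M. \<phi>\<^sub>2 x * f i x)
      (\<lambda>i. LINT x|M. \<phi>\<^sub>3 x * f i x))"
proof -
  have "has_bochner_integral (M \<Otimes>\<^sub>M (M \<Otimes>\<^sub>M M))
    (\<lambda>u. \<Sum>i1\<in>UNIV. \<Sum>i2\<in>UNIV. \<Sum>i3\<in>UNIV.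
       invariant_dist Q $ i1 * Q $ i1 $ i2 * Q $ i2 $ i3 *
       (case u of (x, y, z) \<Rightarrow> (\<phi>\<^sub>1 x * f i1 x) * (\<phi>\<^sub>2 y * f i2 y) * (\<phi>\<^sub>3 z * f i3 z)))
    (moment3 Q (\<lambda>i. LINT x|M. \<phi>\<^sub>1 x * f i x) (\<lambda>i. LINT x|M. \<phi>\<^sub>2 x * f i x)
      (\<lambda>i. LINT x|M. \<phi>\<^sub>3 x * f i x))"
    unfolding moment3_def
    by (rule has_bochner_integral_sum has_bochner_integral_mult_right
        has_bochner_integral_mult_triple assms)+
  moreover have "(\<lambda>u. \<Sum>i1\<in>UNIV. \<Sum>i2\<in>UNIV. \<Sum>i3\<in>UNIV.
       invariant_dist Q $ i1 * Q $ i1 $ i2 * Q $ i2 $ i3 *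
       (case u of (x, y, z) \<Rightarrow> (\<phi>\<^sub>1 x * f i1 x) * (\<phi>\<^sub>2 y * f i2 y) * (\<phi>\<^sub>3 z * f i3 z)))
    = (\<lambda>(x, y, z). \<phi>\<^sub>1 x * \<phi>\<^sub>2 y * \<phi>\<^sub>3 z * moment3 Q (\<lambda>i. f i x) (\<lambda>i. f i y) (\<lambda>i. f i z))"
    unfolding moment3_def sum_distrib_left
    by (intro ext) (clarify, intro sum.cong refl, simp add: mult_ac)
  ultimately show ?thesis by metis
qed


section \<open>Norm estimates on the observation space\<close>

lemma sigma_finite_obs_measure:
  assumes "Y \<in> sets lborel"
  shows "sigma_finite_measure (obs_measure Y)"
  unfolding obs_measure_def
  by (rule sigma_finite_measure_restrict_space) (use assms in \<open>auto intro: sigma_finite_lborel\<close>)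

lemma L1_norm_nonneg: "0 \<le> L1_norm M h"
  by (simp add: L1_norm_def)

lemma L1_norm_diff:
  assumes "integrable M h" "integrable M k"
  shows "L1_norm M (\<lambda>x. h x - k x) \<le> L1_norm M h + L1_norm M k"
proof -
  have "L1_norm M (\<lambda>x. h x - k x) \<le> (LINT x|M. \<bar>h x\<bar> + \<bar>k x\<bar>)"
    unfolding L1_norm_def using assms by (intro integral_mono) auto
  then show ?thesis using assms by (simp add: L1_norm_def)
qed

lemma L1_norm_sum:
  assumes "\<And>i. i \<in> I \<Longrightarrow> integrable M (h i)"
  shows "L1_norm M (\<lambda>x. \<Sum>i\<in>I. c i * h i x) \<le> (\<Sum>i\<in>I. \<bar>c i\<bar> * L1_norm M (h i))"
proof -
  have "L1_norm M (\<lambda>x. \<Sum>i\<in>I. c i * h i x) \<le> (LINT x|M. (\<Sum>i\<in>I. \<bar>c i\<bar> * \<bar>h i x\<bar>))"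
    unfolding L1_norm_def using assms
    by (intro integral_mono) (auto simp flip: abs_mult)
  also have "\<dots> = (\<Sum>i\<in>I. \<bar>c i\<bar> * L1_norm M (h i))"
    unfolding L1_norm_def using assms by (subst Bochner_Integration.integral_sum) auto
  finally show ?thesis .
qed

lemma prob_density_onD:
  assumes "prob_density_on Y h"
  shows "integrable (obs_measure Y) h" "(LINT y|obs_measure Y. h y) = 1"
    "L1_norm (obs_measure Y) h = 1" "\<And>y. y \<in> space (obs_measure Y) \<Longrightarrow> 0 \<le> h y"
proof -
  show nn: "0 \<le> h y" if "y \<in> space (obs_measure Y)" for y
    using that assms by (auto simp: prob_density_on_def obs_measure_def space_restrict_space)
  show "integrable (obs_measure Y) h" "(LINT y|obs_measure Y. h y) = 1"
    using assms by (auto simp: prob_density_on_def has_bochner_integral_iff)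
  moreover have "L1_norm (obs_measure Y) h = (LINT y|obs_measure Y. h y)"
    unfolding L1_norm_def by (intro Bochner_Integration.integral_cong) (auto simp: nn)
  ultimately show "L1_norm (obs_measure Y) h = 1" by simp
qed

text \<open>Both moments integrate the same product test function, which is bounded by
  \<open>B ^ 3\<close>, so their difference is an integral against the difference of the joint
  densities.\<close>

lemma moment3_diff_le:
  fixes f f' :: "'n::finite \<Rightarrow> real \<Rightarrow> real"
  assumes Y: "Y \<in> sets lborel"
    and f: "\<And>i. integrable (obs_measure Y) (f i)" and f': "\<And>i. integrable (obs_measure Y) (f' i)"
    and meas [measurable]: "\<phi>\<^sub>1 \<in> borel_measurable (obs_measure Y)"
      "\<phi>\<^sub>2 \<in> borel_measurable (obs_measure Y)" "\<phi>\<^sub>3 \<in> borel_measurable (obs_measure Y)"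
    and B: "\<And>y. \<bar>\<phi>\<^sub>1 y\<bar> \<le> B" "\<And>y. \<bar>\<phi>\<^sub>2 y\<bar> \<le> B" "\<And>y. \<bar>\<phi>\<^sub>3 y\<bar> \<le> B"
  shows "\<bar>moment3 Q (\<lambda>i. LINT y|obs_measure Y. \<phi>\<^sub>1 y * f i y)
        (\<lambda>i. LINT y|obs_measure Y. \<phi>\<^sub>2 y * f i y) (\<lambda>i. LINT y|obs_measure Y. \<phi>\<^sub>3 y * f i y)
      - moment3 Q (\<lambda>i. LINT y|obs_measure Y. \<phi>\<^sub>1 y * f' i y)
        (\<lambda>i. LINT y|obs_measure Y. \<phi>\<^sub>2 y * f' i y) (\<lambda>i. LINT y|obs_measure Y. \<phi>\<^sub>3 y * f' i y)\<bar>
    \<le> B ^ 3 * hmm_density3_dist Y Q f f'" (is "\<bar>?m - ?m'\<bar> \<le> _")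
proof -
  let ?M = "obs_measure Y"
  let ?M3 = "?M \<Otimes>\<^sub>M (?M \<Otimes>\<^sub>M ?M)"
  let ?\<Phi> = "\<lambda>(x, y, z). \<phi>\<^sub>1 x * \<phi>\<^sub>2 y * \<phi>\<^sub>3 z"
  interpret sigma_finite_measure ?M using Y by (rule sigma_finite_obs_measure)
  \<comment> \<open>The moment lemma with all test functions equal to 1 gives integrability of the
    density itself.\<close>
  have int: "integrable ?M3 (hmm_density3 Q g)" if "\<And>i. integrable ?M (g i)" for g
    using has_bochner_integral_hmm_density3[of "\<lambda>_. 1" g "\<lambda>_. 1" "\<lambda>_. 1" Q] that
    by (simp add: has_bochner_integral_iff hmm_density3_eq_moment3[symmetric] case_prod_beta)
  have hbi: "has_bochner_integral ?M3 (\<lambda>u. ?\<Phi> u * hmm_density3 Q g u)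
      (moment3 Q (\<lambda>i. LINT y|?M. \<phi>\<^sub>1 y * g i y) (\<lambda>i. LINT y|?M. \<phi>\<^sub>2 y * g i y)
        (\<lambda>i. LINT y|?M. \<phi>\<^sub>3 y * g i y))" if "\<And>i. integrable ?M (g i)" for g
  proof -
    have "(\<lambda>u. ?\<Phi> u * hmm_density3 Q g u) = (\<lambda>(x, y, z). \<phi>\<^sub>1 x * \<phi>\<^sub>2 y * \<phi>\<^sub>3 z *
        moment3 Q (\<lambda>i. g i x) (\<lambda>i. g i y) (\<lambda>i. g i z))"
      by (auto simp: hmm_density3_eq_moment3)
    then show ?thesis
      using has_bochner_integral_hmm_density3[of \<phi>\<^sub>1 g \<phi>\<^sub>2 \<phi>\<^sub>3 Q]
      using integrable_bounded_mult[OF that meas(1), of B] integrable_bounded_mult[OF that meas(2), of B]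
        integrable_bounded_mult[OF that meas(3), of B] B by simp
  qed
  have "has_bochner_integral ?M3 (\<lambda>u. ?\<Phi> u * hmm_density3 Q f u - ?\<Phi> u * hmm_density3 Q f' u) (?m - ?m')"
    using hbi[OF f] hbi[OF f'] by (rule has_bochner_integral_diff)
  then have "?m - ?m' = (LINT u|?M3. ?\<Phi> u * (hmm_density3 Q f u - hmm_density3 Q f' u))"
    by (simp add: has_bochner_integral_iff right_diff_distrib)
  also have "\<bar>\<dots>\<bar> \<le> B ^ 3 * L1_norm ?M3 (\<lambda>u. hmm_density3 Q f u - hmm_density3 Q f' u)"
  proof (rule integral_abs_le_bounded_mult)
    have "0 \<le> B" using B(1)[of 0] by simp
    then have "\<bar>\<phi>\<^sub>1 x * \<phi>\<^sub>2 y * \<phi>\<^sub>3 z\<bar> \<le> B * B * B" for x y z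
      unfolding abs_mult by (intro mult_mono B) auto
    then show "\<bar>?\<Phi> u\<bar> \<le> B ^ 3" for u
      by (simp add: case_prod_beta power3_eq_cube)
  qed (use int[OF f] int[OF f'] in \<open>auto simp: case_prod_beta\<close>)
  finally show ?thesis by (simp add: hmm_density3_dist_def)
qed

text \<open>The third state sums out because the rows of \<open>Q\<close> sum to one.\<close>

lemma moment3_const_right:
  assumes "transition_matrix Q"
  shows "moment3 Q a b (\<lambda>_. 1)
    = (\<Sum>i\<in>UNIV. \<Sum>j\<in>UNIV. invariant_dist Q $ i * Q $ i $ j * (a i * b j))"
proof -
  have "moment3 Q a b (\<lambda>_. 1) = (\<Sum>i\<in>UNIV. \<Sum>j\<in>UNIV. \<Sum>k\<in>UNIV.
      invariant_dist Q $ i * Q $ i $ j * (a i * b j) * Q $ j $ k)"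
    unfolding moment3_def by (intro sum.cong refl) (simp add: mult_ac)
  then show ?thesis using assms by (simp add: transition_matrix_def flip: sum_distrib_left)
qed

text \<open>
  The \<open>L\<^sup>1\<close> norm of the difference of the functions of \<open>y\<^sub>2\<close> is itself a moment, namely the one
  with the sign of that difference as the test function of \<open>y\<^sub>2\<close>.
\<close>

lemma L1_norm_partial_moment_le:
  fixes f f' :: "'n::finite \<Rightarrow> real \<Rightarrow> real"
  assumes Y: "Y \<in> sets lborel" and Q: "transition_matrix Q"
    and f: "\<And>i. prob_density_on Y (f i)" and f': "\<And>i. prob_density_on Y (f' i)"
    and meas [measurable]: "\<phi> \<in> borel_measurable (obs_measure Y)"
    and B: "\<And>y. \<bar>\<phi> y\<bar> \<le> B" "1 \<le> B"
  shows "L1_norm (obs_measure Y) (\<lambda>y.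
      (\<Sum>j\<in>UNIV. (\<Sum>i\<in>UNIV. (LINT y|obs_measure Y. \<phi> y * f i y) * (invariant_dist Q $ i * Q $ i $ j)) * f j y)
    - (\<Sum>j\<in>UNIV. (\<Sum>i\<in>UNIV. (LINT y|obs_measure Y. \<phi> y * f' i y) * (invariant_dist Q $ i * Q $ i $ j)) * f' j y))
    \<le> B ^ 3 * hmm_density3_dist Y Q f f'" (is "L1_norm ?M ?h \<le> _")
proof -
  \<comment> \<open>Multiplying by this sign turns the signed difference into its absolute
    value.\<close>
  define \<psi> where "\<psi> y = sgn (?h y)" for y
  note fi = prob_density_onD(1)[OF f] prob_density_onD(1)[OF f']
  have [measurable]: "f i \<in> borel_measurable ?M" "f' i \<in> borel_measurable ?M" for i
    using fi by auto
  have \<psi> [measurable]: "\<psi> \<in> borel_measurable ?M"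
    unfolding \<psi>_def by measurable
  have \<psi>1: "\<bar>\<psi> y\<bar> \<le> 1" for y by (simp add: \<psi>_def sgn_if)
  have \<psi>f: "integrable ?M (\<lambda>y. \<psi> y * f i y)" "integrable ?M (\<lambda>y. \<psi> y * f' i y)" for i
    using \<psi>1 by (auto intro!: integrable_bounded_mult[of _ _ _ 1] fi)
  have mom: "moment3 Q (\<lambda>i. LINT y|?M. \<phi> y * g i y) (\<lambda>i. LINT y|?M. \<psi> y * g i y) (\<lambda>i. LINT y|?M. 1 * g i y)
     = (\<Sum>j\<in>UNIV. (\<Sum>i\<in>UNIV. (LINT y|?M. \<phi> y * g i y) * (invariant_dist Q $ i * Q $ i $ j)) * (LINT y|?M. \<psi> y * g j y))"
    if "\<And>i. prob_density_on Y (g i)" for g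
    using prob_density_onD(2)[OF that]
    by (simp add: moment3_const_right[OF Q] sum_distrib_right sum_distrib_left mult_ac)
      (rule sum.swap)
  have "L1_norm ?M ?h = (LINT y|?M. \<psi> y * ?h y)"
    unfolding L1_norm_def \<psi>_def by (intro Bochner_Integration.integral_cong refl abs_sgn[THEN trans])
      (simp add: mult.commute)
  also have "\<dots> = (LINT y|?M.
      (\<Sum>j\<in>UNIV. (\<Sum>i\<in>UNIV. (LINT y|?M. \<phi> y * f i y) * (invariant_dist Q $ i * Q $ i $ j)) * (\<psi> y * f j y))
    - (\<Sum>j\<in>UNIV. (\<Sum>i\<in>UNIV. (LINT y|?M. \<phi> y * f' i y) * (invariant_dist Q $ i * Q $ i $ j)) * (\<psi> y * f' j y)))"
    by (intro Bochner_Integration.integral_cong refl)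
      (simp only: right_diff_distrib sum_distrib_left[of "\<psi> _"] mult.left_commute[of "\<psi> _"])
  also have "\<dots> = moment3 Q (\<lambda>i. LINT y|?M. \<phi> y * f i y) (\<lambda>i. LINT y|?M. \<psi> y * f i y) (\<lambda>i. LINT y|?M. 1 * f i y)
     - moment3 Q (\<lambda>i. LINT y|?M. \<phi> y * f' i y) (\<lambda>i. LINT y|?M. \<psi> y * f' i y) (\<lambda>i. LINT y|?M. 1 * f' i y)"
    unfolding mom[OF f] mom[OF f'] using \<psi>f by simp
  also have "\<dots> \<le> B ^ 3 * hmm_density3_dist Y Q f f'"
    \<comment> \<open>Since \<open>1 \<le> B\<close>, the bound \<open>B\<close> covers the test
      functions \<open>\<phi>\<close>, \<open>\<psi>\<close> and the constant 1 alike.\<close>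
    by (rule order_trans[OF abs_ge_self moment3_diff_le[OF Y fi]])
      (use B order_trans[OF \<psi>1] in auto)
  finally show ?thesis .
qed

section \<open>Bounded test functions dual to linearly independent emissions\<close>

lemma measure_emission_distr:
  assumes h: "prob_density_on Y h" and A: "A \<in> sets (obs_measure Y)"
  shows "measure (emission_distr Y h) A = (LINT y|obs_measure Y. indicator A y * h y)"
proof -
  have "measure (emission_distr Y h) A = (LINT y|emission_distr Y h. indicator A y)"
    using A by (simp add: emission_distr_def)
  also have "\<dots> = (LINT y|obs_measure Y. h y * indicator A y)"
    unfolding emission_distr_def using A prob_density_onD[OF h]
    by (subst integral_density) (auto intro!: AE_I2)
  finally show ?thesis by (simp add: mult.commute)
qed

text \<open>The vectors of integrals attained by bounded test functions form a subspace. Were it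
  proper, some nonzero vector would be orthogonal to it, in particular to the vectors coming from
  indicators, and so would be a linear relation between the emission distributions. Hence the unit
  vectors are attained.\<close>

lemma dual_test_functions:
  fixes f :: "'n::finite \<Rightarrow> real \<Rightarrow> real"
  assumes f: "\<And>r. prob_density_on Y (f r)" and indep: "lin_indep_distrs Y f"
  obtains \<phi> B where "1 \<le> B" "\<And>a. \<phi> a \<in> borel_measurable (obs_measure Y)" "\<And>a y. \<bar>\<phi> a y\<bar> \<le> B"
    "\<And>a r. (LINT y|obs_measure Y. \<phi> a y * f r y) = (if a = r then 1 else 0)"
proof -
  let ?M = "obs_measure Y"
  define T :: "(real ^ 'n) set" where "T = {v. \<exists>\<phi> B. \<phi> \<in> borel_measurable ?M \<and>
    (\<forall>y. \<bar>\<phi> y\<bar> \<le> B) \<and> (\<forall>r. (LINT y|?M. \<phi> y * f r y) = v $ r)}"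
  note fi = prob_density_onD(1)[OF f]
  have "subspace T"
  proof (rule subspaceI)
    show "0 \<in> T" unfolding T_def
      by (auto intro!: exI[of _ "\<lambda>_. 0"] exI[of _ 0])
    fix u v c assume "u \<in> T"
    then obtain \<phi> B where u: "\<phi> \<in> borel_measurable ?M" "\<And>y. \<bar>\<phi> y\<bar> \<le> B"
      "\<And>r. (LINT y|?M. \<phi> y * f r y) = u $ r"
      unfolding T_def by blast
    have "\<bar>c * \<phi> y\<bar> \<le> \<bar>c\<bar> * B" for y
      unfolding abs_mult by (intro mult_left_mono u) auto
    then show "c *\<^sub>R u \<in> T" unfolding T_def
      using u by (auto simp: mult.assoc intro!: exI[of _ "\<lambda>y. c * \<phi> y"] exI[of _ "\<bar>c\<bar> * B"])
    assume "v \<in> T"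
    then obtain \<psi> B' where v: "\<psi> \<in> borel_measurable ?M" "\<And>y. \<bar>\<psi> y\<bar> \<le> B'"
      "\<And>r. (LINT y|?M. \<psi> y * f r y) = v $ r"
      unfolding T_def by blast
    have "(LINT y|?M. (\<phi> y + \<psi> y) * f r y) = u $ r + v $ r" for r
      using integrable_bounded_mult[OF fi u(1), of B] integrable_bounded_mult[OF fi v(1), of B'] u v
      by (simp add: distrib_right)
    moreover have "\<bar>\<phi> y + \<psi> y\<bar> \<le> B + B'" for y
      using u(2)[of y] v(2)[of y] by linarith
    ultimately show "u + v \<in> T" unfolding T_def
      using u(1) v(1) by (auto intro!: exI[of _ "\<lambda>y. \<phi> y + \<psi> y"] exI[of _ "B + B'"])
  qed
  have "T = UNIV"
  proof (rule ccontr)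
    assume "T \<noteq> UNIV"
    moreover have span: "span T = T" using \<open>subspace T\<close> by (simp add: span_eq_iff)
    ultimately obtain c where c: "c \<noteq> 0" "\<And>x. x \<in> T \<Longrightarrow> c \<bullet> x = 0"
      using span_not_UNIV_orthogonal[of T] unfolding span by blast
    have "(\<Sum>r\<in>UNIV. c $ r * measure (emission_distr Y (f r)) A) = 0" if A: "A \<in> sets ?M" for A
    proof -
      have "(\<chi> r. measure (emission_distr Y (f r)) A) \<in> T"
        unfolding T_def using A
        by (auto simp: measure_emission_distr[OF f] intro!: exI[of _ "indicator A"] exI[of _ 1])
      from c(2)[OF this] show ?thesis by (simp add: inner_vec_def)
    qed
    then have "c $ r = 0" for r using indep unfolding lin_indep_distrs_def by blast
    then show False using c(1) by (simp add: vec_eq_iff)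
  qed
  then have "\<forall>a. \<exists>\<phi> B. \<phi> \<in> borel_measurable ?M \<and> (\<forall>y. \<bar>\<phi> y\<bar> \<le> B) \<and>
      (\<forall>r. (LINT y|?M. \<phi> y * f r y) = axis a 1 $ r)"
    unfolding T_def by blast
  then obtain \<phi> B where \<phi>: "\<And>a. \<phi> a \<in> borel_measurable ?M" "\<And>a y. \<bar>\<phi> a y\<bar> \<le> B a"
    "\<And>a r. (LINT y|?M. \<phi> a y * f r y) = axis a 1 $ r"
    by metis
  \<comment> \<open>The sum makes the bound uniform over the finitely many test functions, and the 1
    makes it at least 1.\<close>
  define B\<^sub>0 where "B\<^sub>0 = 1 + (\<Sum>a\<in>UNIV. \<bar>B a\<bar>)"
  have "\<bar>\<phi> a y\<bar> \<le> B\<^sub>0" for a y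
    using \<phi>(2)[of a y] member_le_sum[of a UNIV "\<lambda>a. \<bar>B a\<bar>"] by (force simp: B\<^sub>0_def)
  moreover have "1 \<le> B\<^sub>0" by (simp add: B\<^sub>0_def sum_nonneg)
  moreover have "(LINT y|?M. \<phi> a y * f r y) = (if a = r then 1 else 0)" for a r
    using \<phi>(3) by (simp add: axis_def)
  ultimately show ?thesis using \<phi>(1) that by blast
qed

text \<open>Weighting the middle observation inserts a diagonal factor between the two transitions.
  For \<open>v = 1\<close> this factor is the identity, which leaves the law of the first and third
  observations.\<close>

lemma moment3_eq_matrix:
  fixes Q M :: "real ^ 'n ^ 'n"
  shows "moment3 Q (($) (M $ a)) (($) v) (($) (M $ c))
    = (M ** (diag_matrix (invariant_dist Q) ** Q) ** diag_matrix v ** Q ** transpose M) $ a $ c"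
proof -
  let ?S = "diag_matrix (invariant_dist Q) ** Q"
  have "moment3 Q (($) (M $ a)) (($) v) (($) (M $ c))
      = (\<Sum>i\<in>UNIV. \<Sum>j\<in>UNIV. \<Sum>k\<in>UNIV. M $ a $ i * ?S $ i $ j * v $ j * Q $ j $ k * M $ c $ k)"
    unfolding moment3_def by (intro sum.cong refl) (simp add: mult_ac)
  \<comment> \<open>The sums are reordered to match the nesting of the left-associated matrix
    product.\<close>
  also have "\<dots> = (\<Sum>j\<in>UNIV. \<Sum>i\<in>UNIV. \<Sum>k\<in>UNIV. M $ a $ i * ?S $ i $ j * v $ j * Q $ j $ k * M $ c $ k)"
    by (rule sum.swap)
  also have "\<dots> = (\<Sum>j\<in>UNIV. \<Sum>k\<in>UNIV. \<Sum>i\<in>UNIV. M $ a $ i * ?S $ i $ j * v $ j * Q $ j $ k * M $ c $ k)"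
    by (intro sum.cong refl sum.swap)
  also have "\<dots> = (\<Sum>k\<in>UNIV. \<Sum>j\<in>UNIV. \<Sum>i\<in>UNIV. M $ a $ i * ?S $ i $ j * v $ j * Q $ j $ k * M $ c $ k)"
    by (rule sum.swap)
  also have "\<dots> = (\<Sum>k\<in>UNIV. \<Sum>j\<in>UNIV. (\<Sum>i\<in>UNIV. M $ a $ i * ?S $ i $ j) * v $ j * Q $ j $ k * M $ c $ k)"
    by (simp only: sum_distrib_right)
  also have "\<dots> = (\<Sum>k\<in>UNIV. \<Sum>j\<in>UNIV. (M ** ?S ** diag_matrix v) $ a $ j * Q $ j $ k * M $ c $ k)"
    by (simp only: matrix_mult_diag_matrix) (simp only: matrix_matrix_mult_def vec_lambda_beta)
  also have "\<dots> = (\<Sum>k\<in>UNIV. (M ** ?S ** diag_matrix v ** Q) $ a $ k * transpose M $ k $ c)"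
    unfolding matrix_matrix_mult_def[of _ Q] transpose_def by (simp add: sum_distrib_right)
  finally show ?thesis by (simp add: matrix_matrix_mult_def[of _ "transpose M"])
qed

lemma moment3_const_eq_matrix:
  fixes Q M :: "real ^ 'n ^ 'n"
  assumes "transition_matrix Q"
  shows "moment3 Q (($) (M $ a)) (($) (M $ b)) (\<lambda>_. 1)
    = (M ** (diag_matrix (invariant_dist Q) ** Q) ** transpose M) $ a $ b"
proof -
  let ?S = "diag_matrix (invariant_dist Q) ** Q"
  have "moment3 Q (($) (M $ a)) (($) (M $ b)) (\<lambda>_. 1)
      = (\<Sum>i\<in>UNIV. \<Sum>j\<in>UNIV. M $ a $ i * ?S $ i $ j * M $ b $ j)"
    unfolding moment3_const_right[OF assms] by (intro sum.cong refl) (simp add: mult_ac)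
  also have "\<dots> = (\<Sum>j\<in>UNIV. (\<Sum>i\<in>UNIV. M $ a $ i * ?S $ i $ j) * M $ b $ j)"
    by (subst sum.swap) (simp only: sum_distrib_right)
  finally show ?thesis
    unfolding matrix_matrix_mult_def[of _ "transpose M"]
    by (simp add: matrix_matrix_mult_def[of M] transpose_def)
qed

section \<open>Symmetries of the labels\<close>

lemma finite_label_symmetries: "finite (label_symmetries Q)"
  by (rule finite_subset[of _ "{\<tau>. \<tau> permutes UNIV}"])
    (auto simp: label_symmetries_def intro: finite_permutations)

lemma emission_dist_le:
  assumes "\<tau> \<in> label_symmetries Q"
  shows "emission_dist Y Q f f' \<le> (\<Sum>r\<in>UNIV. L1_norm (obs_measure Y) (\<lambda>y. f (\<tau> r) y - f' r y))"
  unfolding emission_dist_def using assms finite_label_symmetries[of Q] by (intro Min_le) auto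

section \<open>Stability of the emission densities\<close>

theorem theorem4:
  fixes Y :: "real set"
    and Qs :: "real ^ 'n ^ 'n"
    and fs :: "'n \<Rightarrow> real \<Rightarrow> real"
  assumes "Y = {0..1} \<or> Y = UNIV"
    and "transition_matrix Qs"
    and "\<And>r. prob_density_on Y (fs r)"
    and "assumption_A1 Y Qs fs"
    and "assumption_A3 Qs"
    and "assumption_A4 Y fs"
  shows "\<exists>C>0. \<exists>\<delta>>0. \<forall>f :: 'n \<Rightarrow> real \<Rightarrow> real.
           (\<forall>r. prob_density_on Y (f r)) \<longrightarrow>
           hmm_density3_dist Y Qs f fs < \<delta> \<longrightarrow>
           emission_dist Y Qs f fs \<le> C * hmm_density3_dist Y Qs f fs"
proof -
  let ?M = "obs_measure Y"
  have Y: "Y \<in> sets lborel" using assms(1) by auto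
  define p where "p = invariant_dist Qs"
  note p = invariant_dist[OF assms(2,5), folded p_def]
  \<comment> \<open>\<open>S\<close> is the joint law of two consecutive hidden states.\<close>
  define S where "S = diag_matrix p ** Qs"
  have S_nth: "S $ i $ j = p $ i * Qs $ i $ j" for i j by (simp add: S_def)
  have Q_inv: "invertible Qs" using assms(4) by (simp add: assumption_A1_def invertible_det_nz)
  have p0: "p $ i \<noteq> 0" for i using p(1)[of i] by simp
  have "invertible (diag_matrix p)"
  proof -
    have "diag_matrix p ** diag_matrix (\<chi> i. 1 / p $ i) = mat 1"
      "diag_matrix (\<chi> i. 1 / p $ i) ** diag_matrix p = mat 1"
      by (simp_all add: vec_eq_iff p0) (simp_all add: diag_matrix_def mat_def p0)
    then show ?thesis unfolding invertible_def by blast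
  qed
  then have S_inv: "invertible S" unfolding S_def using Q_inv by (rule invertible_mult)
  then obtain S' where S': "S' ** S = mat 1" by (auto simp: invertible_def)
  obtain \<phi> B where B: "1 \<le> B" and \<phi> [measurable]: "\<And>a. \<phi> a \<in> borel_measurable ?M"
    and \<phi>B: "\<And>a y. \<bar>\<phi> a y\<bar> \<le> B"
    and dual: "\<And>a r. (LINT y|?M. \<phi> a y * fs r y) = (if a = r then 1 else 0)"
    by (rule dual_test_functions[OF assms(3) assms(4)[unfolded assumption_A1_def, THEN conjunct2]])
      (rule that)
  have "0 \<le> B" using B by simp
  obtain K \<delta> where K: "0 < K" and \<delta>: "0 < \<delta>"
    and near: "\<And>M d. (\<And>a i. \<bar>M $ a $ i\<bar> \<le> B) \<Longrightarrow> d < \<delta> \<Longrightarrow>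
    (\<And>b. entry_norm (M ** S ** diag_matrix (M $ b) ** Qs ** transpose M
        - S ** diag_matrix (axis b 1) ** Qs) \<le> d) \<Longrightarrow>
    entry_norm (M ** S ** Qs ** transpose M - S ** Qs) \<le> d \<Longrightarrow>
    entry_norm (M ** S ** transpose M - S) \<le> d \<Longrightarrow>
    \<exists>\<sigma>. \<sigma> permutes UNIV \<and> (\<forall>a b. S $ \<sigma> a $ \<sigma> b = S $ a $ b) \<and>
      (\<forall>b i. \<bar>M $ b $ \<sigma> i - (if i = b then 1 else 0)\<bar> \<le> K * d)"
  proof (rule nearby_relabelling[OF S_inv Q_inv \<open>0 \<le> B\<close>], goal_cases)
    case (1 K \<delta>)
    show ?case by (rule 1(1)[OF 1(2-4)])
  qed
  define R where "R = real CARD('n)"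
  have R: "0 < R" by (simp add: R_def)
  \<comment> \<open>Each entry of the moment identities is off by at most \<open>B ^ 3 * d\<close>,
    and a matrix has \<open>R * R\<close> entries.\<close>
  define B\<^sub>3 where "B\<^sub>3 = R * R * B ^ 3"
  have B\<^sub>3: "0 < B\<^sub>3" using R B by (simp add: B\<^sub>3_def)
  \<comment> \<open>The first term bounds the error after testing one observation; the second pays
    for replacing \<open>M\<close> by the permutation matrix.\<close>
  define C\<^sub>1 where "C\<^sub>1 = B ^ 3 + R * R * (K * B\<^sub>3) * entry_norm S"
  have C\<^sub>1: "0 < C\<^sub>1" using B R K B\<^sub>3 entry_norm_nonneg[of S]
    by (simp add: C\<^sub>1_def add_pos_nonneg)
  define C where "C = (entry_norm S' + 1) * C\<^sub>1"
  have C: "0 < C" using C\<^sub>1 entry_norm_nonneg[of S'] by (simp add: C_def)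
  have "emission_dist Y Qs f fs \<le> C * hmm_density3_dist Y Qs f fs"
    if f: "\<And>r. prob_density_on Y (f r)" and small: "hmm_density3_dist Y Qs f fs < \<delta> / B\<^sub>3" for f
  proof -
    define d where "d = hmm_density3_dist Y Qs f fs"
    have d: "0 \<le> d" by (simp add: d_def hmm_density3_dist_def L1_norm_nonneg)
    have d\<delta>: "B\<^sub>3 * d < \<delta>" using small B\<^sub>3 by (simp add: d_def field_simps)
    note fi = prob_density_onD(1)[OF f] and fsi = prob_density_onD(1)[OF assms(3)]
    \<comment> \<open>By duality the corresponding matrix for \<open>fs\<close> is the identity, so
      \<open>M\<close> measures how far \<open>f\<close> is from \<open>fs\<close>.\<close>
    define M :: "real ^ 'n ^ 'n" where "M = (\<chi> a i. LINT y|?M. \<phi> a y * f i y)"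
    have M_nth: "(\<lambda>i. LINT y|?M. \<phi> a y * f i y) = ($) (M $ a)" for a
      by (simp add: M_def fun_eq_iff)
    have I_nth: "(\<lambda>i. LINT y|?M. \<phi> a y * fs i y) = ($) (mat 1 $ a)" for a
      using dual by (auto simp: mat_def)
    have MB: "\<bar>M $ a $ i\<bar> \<le> B" for a i
      using integral_abs_le_bounded_mult[OF fi \<phi> \<phi>B] prob_density_onD(3)[OF f]
      by (simp add: M_def fun_eq_iff)
    have one: "(\<lambda>i. LINT y|?M. 1 * g i y) = ($) 1" if "\<And>i. prob_density_on Y (g i)" for g :: "'n \<Rightarrow> _"
      using prob_density_onD(2)[OF that] by auto
    have one': "($) 1 = (\<lambda>_::'n. 1::real)" by auto
    have axis: "mat 1 $ b = axis b 1" for b :: 'n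
      by (simp add: mat_def axis_def vec_eq_iff)
    \<comment> \<open>The three estimates use the test functions \<open>\<phi> a\<close>,
      \<open>\<phi> b\<close>, \<open>\<phi> c\<close>, then 1 in the middle place, then 1 in the
      last place.\<close>
    have close3: "\<bar>(M ** S ** diag_matrix (M $ b) ** Qs ** transpose M
        - S ** diag_matrix (axis b 1) ** Qs) $ a $ c\<bar> \<le> B ^ 3 * d" for a b c
      using moment3_diff_le[where f = f and f' = fs, OF Y fi fsi \<phi>[of a] \<phi>[of b] \<phi>[of c] \<phi>B \<phi>B \<phi>B, of Qs]
      unfolding M_nth I_nth moment3_eq_matrix p_def[symmetric] S_def[symmetric] d_def[symmetric]
      by (simp add: axis)
    have close13: "\<bar>(M ** S ** Qs ** transpose M - S ** Qs) $ a $ c\<bar> \<le> B ^ 3 * d" for a c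
      using moment3_diff_le[where f = f and f' = fs, OF Y fi fsi \<phi>[of a] _ \<phi>[of c] \<phi>B _ \<phi>B, of "\<lambda>_. 1" Qs] B
      unfolding M_nth I_nth one[OF f] one[OF assms(3)] moment3_eq_matrix
        p_def[symmetric] S_def[symmetric] d_def[symmetric]
      by simp
    have close12: "\<bar>(M ** S ** transpose M - S) $ a $ b\<bar> \<le> B ^ 3 * d" for a b
      using moment3_diff_le[where f = f and f' = fs, OF Y fi fsi \<phi>[of a] \<phi>[of b] _ \<phi>B \<phi>B, of "\<lambda>_. 1" Qs] B
      unfolding M_nth I_nth one[OF f] one[OF assms(3)] one' moment3_const_eq_matrix[OF assms(2)]
        p_def[symmetric] S_def[symmetric] d_def[symmetric]
      by simp
    have bound: "entry_norm X \<le> B\<^sub>3 * d" if "\<And>a c. \<bar>X $ a $ c\<bar> \<le> B ^ 3 * d" for X :: "real ^ 'n ^ 'n"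
      using entry_norm_bound[of X, OF that] by (simp add: B\<^sub>3_def R_def mult.assoc)
    obtain \<sigma> where \<sigma>: "\<sigma> permutes UNIV" and S\<sigma>: "\<And>a b. S $ \<sigma> a $ \<sigma> b = S $ a $ b"
      and M\<sigma>: "\<And>b i. \<bar>M $ b $ \<sigma> i - (if i = b then 1 else 0)\<bar> \<le> K * (B\<^sub>3 * d)"
      using near[OF MB d\<delta> bound[OF close3] bound[OF close13] bound[OF close12]] by blast
    have sum_\<sigma>: "(\<Sum>j\<in>UNIV. h (\<sigma> j)) = (\<Sum>j\<in>UNIV. h j)" for h :: "'n \<Rightarrow> real"
      using sum.permute[OF \<sigma>, of h] by (simp add: o_def)
    \<comment> \<open>The row sums recover \<open>p\<close> from \<open>S\<close>, so
      \<open>\<sigma>\<close> preserves \<open>p\<close>; dividing by the nonzero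
      \<open>p $ a\<close> shows that it preserves \<open>Qs\<close> too.\<close>
    have S_sum: "(\<Sum>j\<in>UNIV. S $ a $ j) = p $ a" for a
      using assms(2) by (simp add: S_nth transition_matrix_def flip: sum_distrib_left)
    have p\<sigma>: "p $ \<sigma> a = p $ a" for a
      using sum_\<sigma>[of "\<lambda>j. S $ \<sigma> a $ j"] by (simp add: S\<sigma> S_sum)
    have "\<sigma> \<in> label_symmetries Qs"
      using \<sigma> S\<sigma> p0 by (simp add: label_symmetries_def vec_eq_iff S_nth p\<sigma>)
    then have "emission_dist Y Qs f fs \<le> (\<Sum>r\<in>UNIV. L1_norm ?M (\<lambda>y. f (\<sigma> r) y - fs r y))"
      by (rule emission_dist_le)
    also have "\<dots> \<le> (\<Sum>r\<in>UNIV. \<Sum>a\<in>UNIV. \<bar>S' $ r $ a\<bar> * (C\<^sub>1 * d))"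
    proof (rule sum_mono)
      fix r
      \<comment> \<open>Here \<open>u\<close> is the relabelled error, \<open>v\<close> is
        \<open>S\<close> applied to \<open>u\<close>, and \<open>w\<close> is the difference
        controlled by testing one observation. The error \<open>u\<close> is recovered from
        \<open>v\<close> through \<open>S'\<close>.\<close>
      define u where "u j y = f (\<sigma> j) y - fs j y" for j y
      define v where "v a y = (\<Sum>j\<in>UNIV. S $ a $ j * u j y)" for a y
      define P :: "real ^ 'n ^ 'n" where "P = (\<chi> b j. if j = \<sigma> b then 1 else 0)"
      define w where "w a y = (\<Sum>j\<in>UNIV. (M ** S) $ a $ j * f j y) - (\<Sum>j\<in>UNIV. S $ a $ j * fs j y)"
        for a y
      have ui: "integrable ?M (u j)" for j unfolding u_def using fi fsi by auto
      have vi: "integrable ?M (v a)" for a unfolding v_def using ui by auto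
      have wi: "integrable ?M (w a)" for a unfolding w_def using fi fsi by auto
      have u: "u r y = (\<Sum>a\<in>UNIV. S' $ r $ a * v a y)" for y
      proof -
        have "(\<Sum>a\<in>UNIV. S' $ r $ a * v a y) = (\<Sum>j\<in>UNIV. (S' ** S) $ r $ j * u j y)"
          unfolding v_def matrix_matrix_mult_def sum_distrib_left
          by (subst sum.swap) (simp add: sum_distrib_right mult.assoc)
        then show ?thesis by (simp add: S' mat_def if_distrib[of "\<lambda>x. x * _"] cong: if_cong)
      qed
      have v: "v a y = w a y - (\<Sum>j\<in>UNIV. ((M - P) ** S) $ a $ j * f j y)" for a y
      proof -
        \<comment> \<open>Reindexing by \<open>\<sigma>\<close> and invariance of \<open>S\<close>
          move the permutation from the densities to the row index, where it becomes the factor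
          \<open>P\<close>.\<close>
        have "(\<Sum>j\<in>UNIV. S $ a $ j * f (\<sigma> j) y) = (\<Sum>j\<in>UNIV. S $ \<sigma> a $ j * f j y)"
          using sum_\<sigma>[of "\<lambda>j. S $ \<sigma> a $ j * f j y"] by (simp add: S\<sigma>)
        also have "\<dots> = (\<Sum>j\<in>UNIV. (P ** S) $ a $ j * f j y)"
          by (simp add: P_def matrix_matrix_mult_def if_distrib[of "\<lambda>x. x * _"] cong: if_cong)
        finally show ?thesis
          by (simp add: v_def u_def w_def matrix_diff_rdistrib right_diff_distrib
              left_diff_distrib sum_subtractf)
      qed
      have w_le: "L1_norm ?M (w a) \<le> B ^ 3 * d" for a
      proof -
        have "(\<Sum>i\<in>UNIV. (LINT y|?M. \<phi> a y * fs i y) * S $ i $ j) = S $ a $ j" for j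
          by (simp add: dual if_distrib[of "\<lambda>x. x * _"] cong: if_cong)
        moreover have "(\<Sum>i\<in>UNIV. (LINT y|?M. \<phi> a y * f i y) * S $ i $ j) = (M ** S) $ a $ j" for j
          by (simp add: M_def matrix_matrix_mult_def)
        ultimately show ?thesis
          using L1_norm_partial_moment_le[where f = f and f' = fs, OF Y assms(2) f assms(3) \<phi>[of a] \<phi>B B]
          by (simp add: w_def[abs_def] d_def flip: p_def S_nth)
      qed
      have MP: "entry_norm (M - P) \<le> R * R * (K * B\<^sub>3) * d"
      proof -
        have "\<bar>(M - P) $ b $ j\<bar> \<le> K * (B\<^sub>3 * d)" for b j
        proof -
          obtain i where "j = \<sigma> i" using \<sigma> by (metis permutes_def)
          then show ?thesis
            using M\<sigma>[of b i] inj_eq[OF permutes_inj[OF \<sigma>]] by (simp add: P_def)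
        qed
        from entry_norm_bound[of "M - P", OF this] show ?thesis by (simp add: R_def mult.assoc)
      qed
      have v_le: "L1_norm ?M (v a) \<le> C\<^sub>1 * d" for a
      proof -
        have "L1_norm ?M (\<lambda>y. \<Sum>j\<in>UNIV. ((M - P) ** S) $ a $ j * f j y)
            \<le> (\<Sum>j\<in>UNIV. \<bar>((M - P) ** S) $ a $ j\<bar> * L1_norm ?M (f j))"
          by (rule L1_norm_sum) (rule fi)
        also have "\<dots> \<le> entry_norm ((M - P) ** S)"
          unfolding entry_norm_def using prob_density_onD(3)[OF f]
          by (simp, intro member_le_sum) (auto intro: sum_nonneg)
        also have "\<dots> \<le> R * R * (K * B\<^sub>3) * d * entry_norm S"
          by (intro entry_norm_mult_le MP order_refl)
        finally have "L1_norm ?M (v a) \<le> B ^ 3 * d + R * R * (K * B\<^sub>3) * d * entry_norm S"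
          using L1_norm_diff[OF wi[of a], of "\<lambda>y. \<Sum>j\<in>UNIV. ((M - P) ** S) $ a $ j * f j y"] w_le[of a] fi
          by (simp add: v[abs_def])
        then show ?thesis by (simp add: C\<^sub>1_def algebra_simps)
      qed
      have "L1_norm ?M (\<lambda>y. f (\<sigma> r) y - fs r y) = L1_norm ?M (\<lambda>y. \<Sum>a\<in>UNIV. S' $ r $ a * v a y)"
        by (simp flip: u add: u_def)
      also have "\<dots> \<le> (\<Sum>a\<in>UNIV. \<bar>S' $ r $ a\<bar> * L1_norm ?M (v a))"
        by (rule L1_norm_sum) (rule vi)
      also have "\<dots> \<le> (\<Sum>a\<in>UNIV. \<bar>S' $ r $ a\<bar> * (C\<^sub>1 * d))"
        by (intro sum_mono mult_left_mono v_le) auto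
      finally show "L1_norm ?M (\<lambda>y. f (\<sigma> r) y - fs r y) \<le> (\<Sum>a\<in>UNIV. \<bar>S' $ r $ a\<bar> * (C\<^sub>1 * d))" .
    qed
    also have "\<dots> = entry_norm S' * (C\<^sub>1 * d)"
      by (simp add: entry_norm_def sum_distrib_right)
    also have "\<dots> \<le> C * d"
      using C\<^sub>1 d by (simp add: C_def algebra_simps)
    finally show ?thesis by (simp add: d_def)
  qed
  moreover have "0 < \<delta> / B\<^sub>3" using \<delta> B\<^sub>3 by simp
  ultimately show ?thesis using C by blast
qed

end
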